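(* Let $\theta\in(0,\pi/4]$, let $|\psi(\theta)\rangle_{AB}=\cos\theta|00\rangle+\sin\theta|11\rangle$, and let $|W\rangle_{A'B'K}=\alpha|001\rangle+\beta|010\rangle+\gamma|100\rangle$ with real $\alpha,\beta,\gamma>0$, $\alpha^2+\beta^2+\gamma^2=1$. (i) In the Bank-measures model, with the Bank measuring $K$ in the basis $\{|+\rangle,|-\rangle\}$ and broadcasting the outcome, the optimal probability (over LOCC protocols of Alice and Bob across $AA'\mid BB'$) of restoring a Bell pair on $AB$ in a branch is $$P_{\max}^{\rm W,meas}(\theta,\beta,\gamma)=\min\Bigl(1,\,2-\cos^2\theta\,\bigl(1+\sqrt{1-4\beta^2\gamma^2}\bigr)\Bigr),$$ and $P_{\max}^{\rm W,meas}(\theta,\beta,\gamma)=1$ exactly when $4\beta^2\gamma^2\ge 1-\tan^4\theta$. (ii) In the transfer model, the optimal probability (over LOCC protocols of Alice and Bob across $AA'K\mid BB'$) of restoring a Bell pair on $AB$ is $$P_{\max}^{\rm W,trans}(\theta,\beta)=\min\Bigl(1,\,2\bigl(1-\cos^2\theta\,\max(\beta^2,1-\beta^2)\bigr)\Bigr).$$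
   Context: All registers $A,B,A',B',K$ are qubits; in $|W\rangle_{A'B'K}$ the tensor factors are ordered $A',B',K$. The global initial state is $|\psi(\theta)\rangle_{AB}\otimes|W\rangle_{A'B'K}$. Alice holds $A,A'$; Bob holds $B,B'$; the Bank holds $K$; $|\pm\rangle=\frac{1}{\sqrt2}(|0\rangle\pm|1\rangle)$. LOCC means local quantum operations by Alice and Bob (local ancillas and discarding of systems allowed) with finitely many rounds of classical communication between them. Bank-measures model: the Bank measures $K$ and broadcasts the classical outcome; afterwards Alice (on $AA'$) and Bob (on $BB'$) act by LOCC, which may depend on the outcome. A branch is the conditional pure state of $AA'BB'$ given the Bank's outcome. Transfer model: the Bank hands $K$ to Alice and is then absent; Alice (holding $AA'K$) and Bob (holding $BB'$) act by LOCC. The probability with which an LOCC protocol restores a Bell pair on $AB$ is the total probability of those (classically known) outcomes of the protocol for which the final state of registers $A$ and $B$ is exactly $|\Phi^+\rangle=\frac{1}{\sqrt2}(|00\rangle+|11\rangle)$, the other registers being left in any state. The optimal probability is the maximum over LOCC protocols. *)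

theory Defs
  imports Complex_Main "Jordan_Normal_Form.Schur_Decomposition"
begin

text \<open>
  Tensor factors are always listed with the leftmost factor most significant: the computational
  basis vector with digits \<open>b\<^sub>1,\<dots>,b\<^sub>n\<close> of an \<open>n\<close>-qubit system has index
  \<open>b\<^sub>1 2\<^bsup>n-1\<^esup> + \<dots> + b\<^sub>n\<close>.
\<close>

definition bits_index :: "nat list \<Rightarrow> nat" where
  "bits_index bs = foldl (\<lambda>n b. 2 * n + b) 0 bs"

definition bit_of :: "nat \<Rightarrow> nat \<Rightarrow> nat" where
  "bit_of i j = (i div 2 ^ j) mod 2"

definition ket :: "nat list \<Rightarrow> complex vec" where
  "ket bs = unit_vec (2 ^ length bs) (bits_index bs)"

definition kron_vec :: "complex vec \<Rightarrow> complex vec \<Rightarrow> complex vec" where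
  "kron_vec v w = vec (dim_vec v * dim_vec w)
     (\<lambda>i. v $ (i div dim_vec w) * w $ (i mod dim_vec w))"

definition kron :: "complex mat \<Rightarrow> complex mat \<Rightarrow> complex mat" where
  "kron A B = mat (dim_row A * dim_row B) (dim_col A * dim_col B)
     (\<lambda>(i, j). A $$ (i div dim_row B, j div dim_col B) * B $$ (i mod dim_row B, j mod dim_col B))"

definition proj :: "complex vec \<Rightarrow> complex mat" where
  "proj v = mat (dim_vec v) (dim_vec v) (\<lambda>(i, j). v $ i * cnj (v $ j))"

definition mat_trace :: "complex mat \<Rightarrow> complex" where
  "mat_trace A = (\<Sum>i<dim_row A. A $$ (i, i))"

definition mat_sum :: "nat \<Rightarrow> complex mat list \<Rightarrow> complex mat" where
  "mat_sum n Ms = foldr (+) Ms (0\<^sub>m n n)"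


section \<open>LOCC protocols\<close>

text \<open>
  A quantum instrument with outcomes \<open>0, \<dots>, outcomes I - 1\<close>. Outcome \<open>i\<close> acts by the completely
  positive map with Kraus operators \<open>kraus I i\<close> and leaves a system of dimension \<open>out_dim I i\<close>.
  Since the output dimension may differ from the input dimension, and since an outcome may have
  several Kraus operators, instruments include adding ancillas, discarding subsystems, and
  forgetting measurement results.
\<close>

datatype instrument =
  Instrument (outcomes: nat) (out_dim: "nat \<Rightarrow> nat") (kraus: "nat \<Rightarrow> complex mat list")

definition is_instrument :: "nat \<Rightarrow> instrument \<Rightarrow> bool" where
  "is_instrument d I \<longleftrightarrow>
     (\<forall>i<outcomes I. 0 < out_dim I i \<and> set (kraus I i) \<subseteq> carrier_mat (out_dim I i) d) \<and>
     mat_sum d (map (\<lambda>K. mat_adjoint K * K) (concat (map (kraus I) [0..<outcomes I]))) = 1\<^sub>m d"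

definition kraus_map :: "nat \<Rightarrow> complex mat list \<Rightarrow> complex mat \<Rightarrow> complex mat" where
  "kraus_map n Ks \<rho> = mat_sum n (map (\<lambda>K. K * \<rho> * mat_adjoint K) Ks)"

definition alice_map :: "instrument \<Rightarrow> nat \<Rightarrow> nat \<Rightarrow> complex mat \<Rightarrow> complex mat" where
  "alice_map I i dB = kraus_map (out_dim I i * dB) (map (\<lambda>K. kron K (1\<^sub>m dB)) (kraus I i))"

definition bob_map :: "instrument \<Rightarrow> nat \<Rightarrow> nat \<Rightarrow> complex mat \<Rightarrow> complex mat" where
  "bob_map I i dA = kraus_map (dA * out_dim I i) (map (\<lambda>K. kron (1\<^sub>m dA) K) (kraus I i))"

text \<open>
  A protocol is a tree. In each round one party applies an instrument and announces the outcome
  \<open>i\<close>; the protocol then continues with the \<open>i\<close>-th subtree. Only subtrees below the number of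
  outcomes are used, and datatype values are well-founded, so there are finitely many rounds.
\<close>

datatype locc =
    Stop
  | Alice_Op instrument "nat \<Rightarrow> locc"
  | Bob_Op instrument "nat \<Rightarrow> locc"

primrec is_protocol :: "locc \<Rightarrow> nat \<Rightarrow> nat \<Rightarrow> bool" where
  "is_protocol Stop dA dB \<longleftrightarrow> True"
| "is_protocol (Alice_Op I Q) dA dB \<longleftrightarrow>
     is_instrument dA I \<and> (\<forall>i<outcomes I. is_protocol (Q i) (out_dim I i) dB)"
| "is_protocol (Bob_Op I Q) dA dB \<longleftrightarrow>
     is_instrument dB I \<and> (\<forall>i<outcomes I. is_protocol (Q i) dA (out_dim I i))"

definition bell :: "complex vec" where
  "bell = complex_of_real (1 / sqrt 2) \<cdot>\<^sub>v (ket [0, 0] + ket [1, 1])"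

text \<open>
  For Alice's space \<open>\<complex>\<^sup>2 \<otimes> \<complex>\<^sup>m\<close> and Bob's space \<open>\<complex>\<^sup>2 \<otimes> \<complex>\<^sup>n\<close>, where the qubits are the registers
  \<open>A\<close> and \<open>B\<close>: the partial trace over the two remaining systems.
\<close>

definition reduced_AB :: "nat \<Rightarrow> nat \<Rightarrow> complex mat \<Rightarrow> complex mat" where
  "reduced_AB m n \<rho> = mat 4 4 (\<lambda>(i, j). \<Sum>x<m. \<Sum>y<n.
     \<rho> $$ (((i div 2) * m + x) * (2 * n) + ((i mod 2) * n + y),
           ((j div 2) * m + x) * (2 * n) + ((j mod 2) * n + y)))"

text \<open>States inside a protocol are unnormalised: the trace is the probability of the outcomes so far.\<close>

definition bell_restored :: "nat \<Rightarrow> nat \<Rightarrow> complex mat \<Rightarrow> bool" where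
  "bell_restored dA dB \<rho> \<longleftrightarrow>
     even dA \<and> even dB \<and> reduced_AB (dA div 2) (dB div 2) \<rho> = mat_trace \<rho> \<cdot>\<^sub>m proj bell"

primrec restoring_prob :: "locc \<Rightarrow> nat \<Rightarrow> nat \<Rightarrow> complex mat \<Rightarrow> real" where
  "restoring_prob Stop dA dB \<rho> = (if bell_restored dA dB \<rho> then Re (mat_trace \<rho>) else 0)"
| "restoring_prob (Alice_Op I Q) dA dB \<rho> =
     (\<Sum>i<outcomes I. restoring_prob (Q i) (out_dim I i) dB (alice_map I i dB \<rho>))"
| "restoring_prob (Bob_Op I Q) dA dB \<rho> =
     (\<Sum>i<outcomes I. restoring_prob (Q i) dA (out_dim I i) (bob_map I i dA \<rho>))"

definition achievable_probs :: "nat \<Rightarrow> nat \<Rightarrow> complex mat \<Rightarrow> real set" where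
  "achievable_probs dA dB \<rho> = {restoring_prob P dA dB \<rho> | P. is_protocol P dA dB}"

definition is_maximum :: "real set \<Rightarrow> real \<Rightarrow> bool" where
  "is_maximum S p \<longleftrightarrow> p \<in> S \<and> (\<forall>q\<in>S. q \<le> p)"


section \<open>The Bank-measures and transfer models\<close>

definition psi_state :: "real \<Rightarrow> complex vec" where
  "psi_state \<theta> = complex_of_real (cos \<theta>) \<cdot>\<^sub>v ket [0, 0] + complex_of_real (sin \<theta>) \<cdot>\<^sub>v ket [1, 1]"

definition W_state :: "real \<Rightarrow> real \<Rightarrow> real \<Rightarrow> complex vec" where
  "W_state \<alpha> \<beta> \<gamma> = complex_of_real \<alpha> \<cdot>\<^sub>v ket [0, 0, 1] + complex_of_real \<beta> \<cdot>\<^sub>v ket [0, 1, 0]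
     + complex_of_real \<gamma> \<cdot>\<^sub>v ket [1, 0, 0]"

text \<open>The global state, with tensor factors in the order \<open>A, B, A', B', K\<close>.\<close>

definition global_state :: "real \<Rightarrow> real \<Rightarrow> real \<Rightarrow> real \<Rightarrow> complex vec" where
  "global_state \<theta> \<alpha> \<beta> \<gamma> = kron_vec (psi_state \<theta>) (W_state \<alpha> \<beta> \<gamma>)"

datatype bank_outcome = Plus | Minus

definition bank_ket :: "bank_outcome \<Rightarrow> complex vec" where
  "bank_ket s = complex_of_real (1 / sqrt 2) \<cdot>\<^sub>v
     (case s of Plus \<Rightarrow> ket [0] + ket [1] | Minus \<Rightarrow> ket [0] - ket [1])"

text \<open>The global state contracted with the bra of \<open>s\<close> on \<open>K\<close>, with factors in the order
  \<open>A, A', B, B'\<close>.\<close>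

definition bank_projected :: "real \<Rightarrow> real \<Rightarrow> real \<Rightarrow> real \<Rightarrow> bank_outcome \<Rightarrow> complex vec" where
  "bank_projected \<theta> \<alpha> \<beta> \<gamma> s = vec 16 (\<lambda>i. \<Sum>k<2. cnj (bank_ket s $ k) *
     global_state \<theta> \<alpha> \<beta> \<gamma> $ bits_index [bit_of i 3, bit_of i 1, bit_of i 2, bit_of i 0, k])"

definition bank_prob :: "real \<Rightarrow> real \<Rightarrow> real \<Rightarrow> real \<Rightarrow> bank_outcome \<Rightarrow> real" where
  "bank_prob \<theta> \<alpha> \<beta> \<gamma> s = (\<Sum>i<16. (cmod (bank_projected \<theta> \<alpha> \<beta> \<gamma> s $ i))\<^sup>2)"

definition bank_branch :: "real \<Rightarrow> real \<Rightarrow> real \<Rightarrow> real \<Rightarrow> bank_outcome \<Rightarrow> complex vec" where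
  "bank_branch \<theta> \<alpha> \<beta> \<gamma> s =
     complex_of_real (1 / sqrt (bank_prob \<theta> \<alpha> \<beta> \<gamma> s)) \<cdot>\<^sub>v bank_projected \<theta> \<alpha> \<beta> \<gamma> s"

text \<open>The success probabilities of complete runs of the Bank-measures model: the parties choose one
  protocol for each outcome announced by the Bank.\<close>

definition bank_achievable_probs :: "real \<Rightarrow> real \<Rightarrow> real \<Rightarrow> real \<Rightarrow> real set" where
  "bank_achievable_probs \<theta> \<alpha> \<beta> \<gamma> =
     {(\<Sum>s\<in>{Plus, Minus}. bank_prob \<theta> \<alpha> \<beta> \<gamma> s *
        restoring_prob (P s) 4 4 (proj (bank_branch \<theta> \<alpha> \<beta> \<gamma> s))) | P. \<forall>s. is_protocol (P s) 4 4}"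

text \<open>The global state with factors in the order \<open>A, A', K, B, B'\<close>.\<close>

definition transfer_state :: "real \<Rightarrow> real \<Rightarrow> real \<Rightarrow> real \<Rightarrow> complex vec" where
  "transfer_state \<theta> \<alpha> \<beta> \<gamma> = vec 32 (\<lambda>i. global_state \<theta> \<alpha> \<beta> \<gamma> $
     bits_index [bit_of i 4, bit_of i 1, bit_of i 3, bit_of i 0, bit_of i 2])"

definition P_max_W_meas :: "real \<Rightarrow> real \<Rightarrow> real \<Rightarrow> real" where
  "P_max_W_meas \<theta> \<beta> \<gamma> = min 1 (2 - (cos \<theta>)\<^sup>2 * (1 + sqrt (1 - 4 * \<beta>\<^sup>2 * \<gamma>\<^sup>2)))"

definition P_max_W_trans :: "real \<Rightarrow> real \<Rightarrow> real" where
  "P_max_W_trans \<theta> \<beta> = min 1 (2 * (1 - (cos \<theta>)\<^sup>2 * max (\<beta>\<^sup>2) (1 - \<beta>\<^sup>2)))"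

end

(*
  Upper bound: write a pure state as a matrix M of amplitudes and let t(M) be its squared
  operator norm, the largest squared Schmidt coefficient. If w is a top right singular vector of
  M, then t(M) = |M w|^2 = sum_k |A_k M w|^2 <= sum_k t(A_k M) for every local instrument (A_k),
  so 2 (|M|^2 - t(M)) does not increase on average under LOCC. A state that contains a Bell pair
  is block diagonal with two equal blocks, whence t(M) <= |M|^2 / 2 and its probability |M|^2 is
  at most 2 (|M|^2 - t(M)). Mixed states occurring in a protocol are kept as ensembles of pure
  states; an ensemble contains a Bell pair only if each member does.

  Lower bound: the squared Schmidt coefficients p_0, ..., p_3 of the product of psi with the
  conditional state of the W qubits are cut into pieces of equal weight on pairs of indices.
  Alice measures which piece, and both parties rotate the resulting pair of equal coefficients
  into a Bell pair. Only the excess of p_0 over the other three cannot be matched.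
*)

theory Submission
  imports Defs "HOL-Analysis.L2_Norm"
begin

section \<open>Ensembles of pure states\<close>

text \<open>Schmidt coefficients belong to vectors, while a protocol may forget results and produce
  mixtures; hence the induction over protocols carries a list of unnormalised vectors, one for each
  sequence of Kraus operators. The monotone is also capped by the squared norm, which yields the
  outer \<open>min 1\<close> of both formulas. Both models are instances of one statement: if the
  state is psi times a state of Schmidt rank two with larger weight \<open>\<mu> 0\<close>, the
  optimum is \<open>min 1 (2 * (1 - q 0 * \<mu> 0))\<close> with
  \<open>q 0 = (cos \<theta>)\<^sup>2\<close>. The product form is what lets four fixed pairs of
  indices suffice, since \<open>p 0 + p 1 = q 0\<close> and \<open>p 0 + p 2 = \<mu> 0\<close> are
  both at least 1/2. After the Bank's measurement the amplitude matrix of the W qubits has rows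
  (\<plusminus>\<alpha>, \<beta>) and (\<gamma>, 0). Its Gram matrix has trace 1 and determinant
  \<open>\<beta>\<^sup>2 * \<gamma>\<^sup>2\<close> for either sign, which gives the square root in
  the first formula. Across A'K and B' the W state is a sum of two biorthogonal terms of weights
  \<open>\<beta>\<^sup>2\<close> and \<open>1 - \<beta>\<^sup>2\<close>, which gives the maximum in
  the second.\<close>

lemma mat_adjoint_carrier [simp]: "A \<in> carrier_mat m n \<Longrightarrow> mat_adjoint A \<in> carrier_mat n m"
  by (auto simp: mat_adjoint_def mat_of_rows_def)

lemma dim_mat_adjoint [simp]:
  "dim_row (mat_adjoint A) = dim_col A" "dim_col (mat_adjoint A) = dim_row A"
  by (auto simp: mat_adjoint_def)

lemma mat_adjoint_index [simp]:
  fixes A :: "complex mat"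
  shows "i < dim_col A \<Longrightarrow> j < dim_row A \<Longrightarrow> mat_adjoint A $$ (i, j) = cnj (A $$ (j, i))"
  by (auto simp: mat_adjoint_def mat_of_rows_def conjugate_complex_def)

lemma proj_carrier [simp]: "v \<in> carrier_vec n \<Longrightarrow> proj v \<in> carrier_mat n n"
  by (auto simp: proj_def)

lemma sandwich_proj:
  assumes "A \<in> carrier_mat m n" "v \<in> carrier_vec n"
  shows "A * proj v * mat_adjoint A = proj (A *\<^sub>v v)"
proof (rule eq_matI)
  fix i j assume "i < dim_row (proj (A *\<^sub>v v))" "j < dim_col (proj (A *\<^sub>v v))"
  then have ij: "i < m" "j < m" using assms by (auto simp: proj_def)
  have "(A * proj v * mat_adjoint A) $$ (i, j)
      = (\<Sum>k<n. (\<Sum>l<n. A $$ (i, l) * (v $ l * cnj (v $ k))) * cnj (A $$ (j, k)))"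
    using assms ij by (simp add: proj_def scalar_prod_def atLeast0LessThan)
  also have "\<dots> = (\<Sum>l<n. A $$ (i, l) * v $ l) * cnj (\<Sum>k<n. A $$ (j, k) * v $ k)"
    by (simp add: sum_product sum_distrib_left sum_distrib_right mult_ac)
  also have "\<dots> = proj (A *\<^sub>v v) $$ (i, j)"
    using assms ij by (simp add: proj_def scalar_prod_def atLeast0LessThan)
  finally show "(A * proj v * mat_adjoint A) $$ (i, j) = proj (A *\<^sub>v v) $$ (i, j)" .
qed (use assms in \<open>auto simp: proj_def\<close>)

lemma mat_sum_simps [simp]:
  "mat_sum n [] = 0\<^sub>m n n" "mat_sum n (M # Ms) = M + mat_sum n Ms"
  by (auto simp: mat_sum_def)

lemma mat_sum_carrier [simp]:
  "set Ms \<subseteq> carrier_mat n n \<Longrightarrow> mat_sum n Ms \<in> carrier_mat n n"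
  by (induction Ms) auto

lemma mat_sum_dim [simp]:
  assumes "set Ms \<subseteq> carrier_mat n n"
  shows "dim_row (mat_sum n Ms) = n" "dim_col (mat_sum n Ms) = n"
  using carrier_matD[OF mat_sum_carrier[OF assms]] by auto

lemma mat_sum_append:
  "set Ms \<subseteq> carrier_mat n n \<Longrightarrow> set Ns \<subseteq> carrier_mat n n
    \<Longrightarrow> mat_sum n (Ms @ Ns) = mat_sum n Ms + mat_sum n Ns"
  by (induction Ms) (auto simp: assoc_add_mat[of _ n n])

lemma mat_sum_concat:
  "(\<And>Ms. Ms \<in> set Mss \<Longrightarrow> set Ms \<subseteq> carrier_mat n n)
    \<Longrightarrow> mat_sum n (concat Mss) = mat_sum n (map (mat_sum n) Mss)"
proof (induction Mss)
  case (Cons Ms Mss)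
  have "set (concat Mss) \<subseteq> carrier_mat n n" using Cons.prems by fastforce
  with Cons show ?case by (simp add: mat_sum_append)
qed simp

lemma mat_sum_index:
  "set Ms \<subseteq> carrier_mat n n \<Longrightarrow> i < n \<Longrightarrow> j < n
    \<Longrightarrow> mat_sum n Ms $$ (i, j) = (\<Sum>M\<leftarrow>Ms. M $$ (i, j))"
proof (induction Ms)
  case (Cons M Ms)
  then have "mat_sum n Ms \<in> carrier_mat n n" by simp
  then have "(M + mat_sum n Ms) $$ (i, j) = M $$ (i, j) + mat_sum n Ms $$ (i, j)"
    using Cons.prems by auto
  with Cons show ?case by simp
qed simp

lemma sandwich_mat_sum:
  assumes A: "A \<in> carrier_mat m n"
  shows "set Ms \<subseteq> carrier_mat n n \<Longrightarrow>
    A * mat_sum n Ms * mat_adjoint A = mat_sum m (map (\<lambda>M. A * M * mat_adjoint A) Ms)"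
proof (induction Ms)
  case Nil
  show ?case using A by (simp add: right_mult_zero_mat[OF A] left_mult_zero_mat[of _ n m])
next
  case (Cons M Ms)
  then have "M \<in> carrier_mat n n" "mat_sum n Ms \<in> carrier_mat n n" by auto
  with Cons A show ?case
    by (simp add: mult_add_distrib_mat[OF A] add_mult_distrib_mat[of _ m n _ _ m])
qed

text \<open>Members are not normalised: the weight of a member is its squared norm, so Kraus
  operators act on the list without any rescaling.\<close>

definition ensemble :: "nat \<Rightarrow> complex vec list \<Rightarrow> complex mat" where
  "ensemble n vs = mat_sum n (map proj vs)"

lemma ensemble_single: "v \<in> carrier_vec n \<Longrightarrow> ensemble n [v] = proj v"
  by (simp add: ensemble_def right_add_zero_mat[of _ n n])

lemma ensemble_index:
  assumes "set vs \<subseteq> carrier_vec n" "i < n" "j < n"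
  shows "ensemble n vs $$ (i, j) = (\<Sum>v\<leftarrow>vs. v $ i * cnj (v $ j))"
proof -
  have "ensemble n vs $$ (i, j) = (\<Sum>v\<leftarrow>vs. proj v $$ (i, j))"
    using assms unfolding ensemble_def by (subst mat_sum_index) (auto simp: o_def)
  also have "\<dots> = (\<Sum>v\<leftarrow>vs. v $ i * cnj (v $ j))"
    using assms by (intro arg_cong[where f = sum_list] map_cong) (auto simp: proj_def)
  finally show ?thesis .
qed

text \<open>A Kraus operator sends a pure member to a pure member. Several operators within one
  outcome only lengthen the list, so forgetting a result costs nothing in this description.\<close>

lemma kraus_map_ensemble:
  assumes vs: "set vs \<subseteq> carrier_vec n" and Ks: "set Ks \<subseteq> carrier_mat m n"
  shows "kraus_map m Ks (ensemble n vs)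
    = ensemble m (concat (map (\<lambda>K. map ((*\<^sub>v) K) vs) Ks))"
proof -
  have dims: "dim_row K = m" if "K \<in> set Ks" for K using that Ks by auto
  have K: "K * ensemble n vs * mat_adjoint K = mat_sum m (map proj (map ((*\<^sub>v) K) vs))"
    if "K \<in> set Ks" for K
    unfolding ensemble_def using that vs Ks
    by (subst sandwich_mat_sum[of _ m n])
      (auto simp: dims intro!: arg_cong[where f = "mat_sum m"] sandwich_proj)
  have "kraus_map m Ks (ensemble n vs)
      = mat_sum m (map (mat_sum m) (map (\<lambda>K. map proj (map ((*\<^sub>v) K) vs)) Ks))"
    unfolding kraus_map_def by (intro arg_cong[where f = "mat_sum m"]) (simp add: K)
  also have "\<dots> = mat_sum m (concat (map (\<lambda>K. map proj (map ((*\<^sub>v) K) vs)) Ks))"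
    using vs Ks
    by (subst mat_sum_concat) (auto intro!: proj_carrier mult_mat_vec_carrier[of _ m n])
  also have "\<dots> = ensemble m (concat (map (\<lambda>K. map ((*\<^sub>v) K) vs) Ks))"
    by (simp add: ensemble_def map_concat o_def)
  finally show ?thesis .
qed

lemma kron_carrier [simp]:
  "A \<in> carrier_mat a b \<Longrightarrow> B \<in> carrier_mat c d \<Longrightarrow> kron A B \<in> carrier_mat (a * c) (b * d)"
  by (auto simp: kron_def)

definition after_alice :: "nat \<Rightarrow> complex mat list \<Rightarrow> complex vec list \<Rightarrow> complex vec list" where
  "after_alice dB Ks vs = concat (map (\<lambda>K. map ((*\<^sub>v) (kron K (1\<^sub>m dB))) vs) Ks)"

definition after_bob :: "nat \<Rightarrow> complex mat list \<Rightarrow> complex vec list \<Rightarrow> complex vec list" where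
  "after_bob dA Ks vs = concat (map (\<lambda>K. map ((*\<^sub>v) (kron (1\<^sub>m dA) K)) vs) Ks)"

lemma alice_map_ensemble:
  assumes "is_instrument dA I" "i < outcomes I" "set vs \<subseteq> carrier_vec (dA * dB)"
  shows "alice_map I i dB (ensemble (dA * dB) vs)
    = ensemble (out_dim I i * dB) (after_alice dB (kraus I i) vs)"
  using assms unfolding alice_map_def after_alice_def is_instrument_def
  by (subst kraus_map_ensemble) (auto simp: o_def intro!: kron_carrier)

lemma bob_map_ensemble:
  assumes "is_instrument dB I" "i < outcomes I" "set vs \<subseteq> carrier_vec (dA * dB)"
  shows "bob_map I i dA (ensemble (dA * dB) vs)
    = ensemble (dA * out_dim I i) (after_bob dA (kraus I i) vs)"
  using assms unfolding bob_map_def after_bob_def is_instrument_def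
  by (subst kraus_map_ensemble) (auto simp: o_def intro!: kron_carrier)

lemma after_alice_carrier:
  assumes "is_instrument dA I" "i < outcomes I" "set vs \<subseteq> carrier_vec (dA * dB)"
  shows "set (after_alice dB (kraus I i) vs) \<subseteq> carrier_vec (out_dim I i * dB)"
  using assms unfolding after_alice_def is_instrument_def
  by (auto intro!: mult_mat_vec_carrier[of _ _ "dA * dB"] kron_carrier)

lemma after_bob_carrier:
  assumes "is_instrument dB I" "i < outcomes I" "set vs \<subseteq> carrier_vec (dA * dB)"
  shows "set (after_bob dA (kraus I i) vs) \<subseteq> carrier_vec (dA * out_dim I i)"
  using assms unfolding after_bob_def is_instrument_def
  by (auto intro!: mult_mat_vec_carrier[of _ _ "dA * dB"] kron_carrier)

lemma sum_lessThan_2: "(\<Sum>k<2. f k) = f 0 + f (1 :: nat)"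
  by (simp add: numeral_2_eq_2)

lemma sum_lessThan_4: "(\<Sum>k<4. f k) = f 0 + f 1 + f 2 + f (3 :: nat)"
  by (simp add: numeral_eq_Suc)

text \<open>Division with remainder by \<open>n\<close>; this is the passage from the flat index of
  a tensor product to a pair of indices.\<close>

lemma sum_mult_block:
  fixes f :: "nat \<Rightarrow> 'a :: comm_monoid_add"
  shows "(\<Sum>k<m * n. f k) = (\<Sum>a<m. \<Sum>b<n. f (a * n + b))"
proof (induction m)
  case (Suc m)
  have *: "(\<Sum>k<p + n. f k) = (\<Sum>k<p. f k) + (\<Sum>b<n. f (p + b))" for p
    by (induction n) (simp_all add: add.assoc)
  from Suc show ?case using *[of "m * n"] by (simp add: add.commute)
qed simp

section \<open>Monotonicity of the largest Schmidt coefficient\<close>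

text \<open>A bipartite vector reshaped to a matrix, with rows for Alice and columns for Bob; its
  singular values are the Schmidt coefficients.\<close>

definition amp :: "nat \<Rightarrow> complex vec \<Rightarrow> nat \<Rightarrow> nat \<Rightarrow> complex" where
  "amp dB v a b = v $ (a * dB + b)"

definition sqnorm :: "nat \<Rightarrow> nat \<Rightarrow> (nat \<Rightarrow> nat \<Rightarrow> complex) \<Rightarrow> real" where
  "sqnorm dA dB M = (\<Sum>a<dA. \<Sum>b<dB. (cmod (M a b))\<^sup>2)"

text \<open>The unit ball instead of the sphere: it contains 0, so the supremum below is over a
  nonempty set in every dimension.\<close>

definition subunit :: "nat \<Rightarrow> (nat \<Rightarrow> complex) \<Rightarrow> bool" where
  "subunit d u \<longleftrightarrow> (\<Sum>a<d. (cmod (u a))\<^sup>2) \<le> 1"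

text \<open>Bilinear, with no conjugate on \<open>u\<close>. The supremum over the ball is the same,
  and the expression becomes symmetric under transposition of \<open>M\<close>.\<close>

definition overlap :: "nat \<Rightarrow> nat \<Rightarrow> (nat \<Rightarrow> nat \<Rightarrow> complex) \<Rightarrow> (nat \<Rightarrow> complex) \<Rightarrow> (nat \<Rightarrow> complex) \<Rightarrow>
    real" where
  "overlap dA dB M u w = (cmod (\<Sum>a<dA. u a * (\<Sum>b<dB. M a b * w b)))\<^sup>2"

text \<open>The squared operator norm of \<open>M\<close>, that is, the largest squared Schmidt coefficient.\<close>

definition top_schmidt :: "nat \<Rightarrow> nat \<Rightarrow> (nat \<Rightarrow> nat \<Rightarrow> complex) \<Rightarrow> real" where
  "top_schmidt dA dB M = Sup {overlap dA dB M u w | u w. subunit dA u \<and> subunit dB w}"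

definition act :: "complex mat \<Rightarrow> (nat \<Rightarrow> nat \<Rightarrow> complex) \<Rightarrow> nat \<Rightarrow> nat \<Rightarrow> complex" where
  "act K M a b = (\<Sum>c<dim_col K. K $$ (a, c) * M c b)"

text \<open>An instrument with the grouping into outcomes erased; the numbers of rows may differ
  from one operator to the next.\<close>

definition complete :: "nat \<Rightarrow> complex mat list \<Rightarrow> bool" where
  "complete d Ks \<longleftrightarrow> (\<forall>K\<in>set Ks. dim_col K = d) \<and>
     mat_sum d (map (\<lambda>K. mat_adjoint K * K) Ks) = 1\<^sub>m d"

section \<open>The operator norm through test vectors\<close>

lemma cmod_sum_mult_le:
  "(cmod (\<Sum>i\<in>A. f i * g i))\<^sup>2 \<le> (\<Sum>i\<in>A. (cmod (f i))\<^sup>2) * (\<Sum>i\<in>A. (cmod (g i))\<^sup>2)"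
proof -
  have "cmod (\<Sum>i\<in>A. f i * g i) \<le> (\<Sum>i\<in>A. \<bar>cmod (f i)\<bar> * \<bar>cmod (g i)\<bar>)"
    by (intro sum_norm_le) (simp add: norm_mult)
  also have "\<dots> \<le> L2_set (\<lambda>i. cmod (f i)) A * L2_set (\<lambda>i. cmod (g i)) A"
    by (rule L2_set_mult_ineq)
  finally have "(cmod (\<Sum>i\<in>A. f i * g i))\<^sup>2 \<le> (L2_set (\<lambda>i. cmod (f i)) A
      * L2_set (\<lambda>i. cmod (g i)) A)\<^sup>2"
    by (intro power_mono) auto
  also have "\<dots> = (\<Sum>i\<in>A. (cmod (f i))\<^sup>2) * (\<Sum>i\<in>A. (cmod (g i))\<^sup>2)"
    by (simp add: L2_set_def power_mult_distrib sum_nonneg)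
  finally show ?thesis .
qed

lemma overlap_le:
  assumes "subunit dA u"
  shows "overlap dA dB M u w \<le> (\<Sum>a<dA. (cmod (\<Sum>b<dB. M a b * w b))\<^sup>2)"
proof -
  have "overlap dA dB M u w
      \<le> (\<Sum>a<dA. (cmod (u a))\<^sup>2) * (\<Sum>a<dA. (cmod (\<Sum>b<dB. M a b * w b))\<^sup>2)"
    unfolding overlap_def by (rule cmod_sum_mult_le)
  also have "\<dots> \<le> 1 * (\<Sum>a<dA. (cmod (\<Sum>b<dB. M a b * w b))\<^sup>2)"
    using assms unfolding subunit_def by (intro mult_right_mono sum_nonneg) auto
  finally show ?thesis by simp
qed

lemma overlap_le_sqnorm:
  assumes "subunit dA u" "subunit dB w"
  shows "overlap dA dB M u w \<le> sqnorm dA dB M"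
proof -
  have "(cmod (\<Sum>b<dB. M a b * w b))\<^sup>2 \<le> (\<Sum>b<dB. (cmod (M a b))\<^sup>2)" for a
  proof -
    have "(cmod (\<Sum>b<dB. M a b * w b))\<^sup>2
        \<le> (\<Sum>b<dB. (cmod (M a b))\<^sup>2) * (\<Sum>b<dB. (cmod (w b))\<^sup>2)"
      by (rule cmod_sum_mult_le)
    also have "\<dots> \<le> (\<Sum>b<dB. (cmod (M a b))\<^sup>2) * 1"
      using assms(2) unfolding subunit_def by (intro mult_left_mono sum_nonneg) auto
    finally show ?thesis by simp
  qed
  then have "(\<Sum>a<dA. (cmod (\<Sum>b<dB. M a b * w b))\<^sup>2) \<le> sqnorm dA dB M"
    unfolding sqnorm_def by (intro sum_mono)
  with overlap_le[OF assms(1), of dB M w] show ?thesis by linarith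
qed

lemma overlap_le_top_schmidt:
  assumes "subunit dA u" "subunit dB w"
  shows "overlap dA dB M u w \<le> top_schmidt dA dB M"
  unfolding top_schmidt_def
  by (intro cSup_upper bdd_aboveI[where M = "sqnorm dA dB M"])
    (use assms overlap_le_sqnorm in auto)

lemma subunit_zero: "subunit d (\<lambda>_. 0)"
  by (simp add: subunit_def)

lemma top_schmidt_le:
  assumes "\<And>u w. subunit dA u \<Longrightarrow> subunit dB w \<Longrightarrow> overlap dA dB M u w \<le> c"
  shows "top_schmidt dA dB M \<le> c"
  unfolding top_schmidt_def using assms subunit_zero by (intro cSup_least) blast+

lemma top_schmidt_nonneg: "0 \<le> top_schmidt dA dB M"
  using overlap_le_top_schmidt[OF subunit_zero subunit_zero, of dA dB M]
  by (simp add: overlap_def)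

lemma sum_norm_le_top_schmidt:
  assumes "subunit dB w"
  shows "(\<Sum>a<dA. (cmod (\<Sum>b<dB. M a b * w b))\<^sup>2) \<le> top_schmidt dA dB M"
proof -
  define y where "y = (\<lambda>a. \<Sum>b<dB. M a b * w b)"
  define N where "N = (\<Sum>a<dA. (cmod (y a))\<^sup>2)"
  \<comment> \<open>Equality case of Cauchy-Schwarz: for fixed \<open>w\<close> the best
    \<open>u\<close> is the conjugate of the normalised image of \<open>w\<close>. It exists only
    for a nonzero image, hence the separate case \<open>N = 0\<close> at the end.\<close>
  define u where "u = (\<lambda>a. cnj (y a) / complex_of_real (sqrt N))"
  have N: "0 \<le> N" unfolding N_def by (intro sum_nonneg) auto
  have "N \<le> top_schmidt dA dB M" if "N > 0"
  proof -
    have "(\<Sum>a<dA. (cmod (u a))\<^sup>2) = 1"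
      using that N by (simp add: u_def norm_divide power_divide flip: sum_divide_distrib N_def)
    then have "overlap dA dB M u w \<le> top_schmidt dA dB M"
      by (intro overlap_le_top_schmidt assms) (simp add: subunit_def)
    moreover have "(\<Sum>a<dA. u a * y a) = complex_of_real (sqrt N)"
    proof -
      have "(\<Sum>a<dA. u a * y a) = (\<Sum>a<dA. complex_of_real ((cmod (y a))\<^sup>2)) / complex_of_real (sqrt
          N)"
        unfolding u_def sum_divide_distrib
        by (intro sum.cong) (simp_all only: complex_norm_square mult.commute times_divide_eq_right)
      also have "(\<Sum>a<dA. complex_of_real ((cmod (y a))\<^sup>2)) = complex_of_real N"
        by (simp add: N_def)
      also have "complex_of_real N / complex_of_real (sqrt N) = complex_of_real (sqrt N)"
        by (metis N of_real_divide real_div_sqrt)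
      finally show ?thesis .
    qed
    ultimately show ?thesis using N by (simp add: overlap_def y_def)
  qed
  with N show ?thesis using top_schmidt_nonneg[of dA dB M] unfolding N_def y_def
    by (cases "N = 0") (auto simp: N_def y_def)
qed

lemma overlap_transpose: "overlap dB dA (\<lambda>b a. M a b) w u = overlap dA dB M u w"
proof -
  have "(\<Sum>b<dB. w b * (\<Sum>a<dA. M a b * u a)) = (\<Sum>a<dA. u a * (\<Sum>b<dB. M a b * w b))"
    by (simp add: sum_distrib_left mult_ac) (subst sum.swap, simp)
  then show ?thesis by (simp add: overlap_def)
qed

lemma top_schmidt_transpose: "top_schmidt dB dA (\<lambda>b a. M a b) = top_schmidt dA dB M"
proof -
  have "overlap dB dA (\<lambda>b a. M a b) w u = overlap dA dB M u w" for u w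
    by (rule overlap_transpose)
  then show ?thesis unfolding top_schmidt_def by (intro arg_cong[where f = Sup]) auto
qed

lemma sqnorm_transpose: "sqnorm dB dA (\<lambda>b a. M a b) = sqnorm dA dB M"
  unfolding sqnorm_def by (rule sum.swap)

section \<open>Norm and top Schmidt coefficient under a local instrument\<close>

lemma complete_sum_norm:
  assumes "complete d Ks"
  shows "(\<Sum>K\<leftarrow>Ks. \<Sum>r<dim_row K. (cmod (\<Sum>c<d. K $$ (r, c) * x c))\<^sup>2) = (\<Sum>c<d. (cmod (x c))\<^sup>2)"
proof -
  have sq: "complex_of_real ((cmod z)\<^sup>2) = cnj z * z" for z
    by (metis complex_norm_square mult.commute)
  \<comment> \<open>\<open>Q A\<close> is the Hermitian form of \<open>A\<close> at
    \<open>x\<close>. It is additive in \<open>A\<close>, so completeness turns the sum of the terms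
    for each operator into the form of the identity.\<close>
  define Q where "Q A = (\<Sum>c<d. \<Sum>e<d. cnj (x c) * A $$ (c, e) * x e)" for A
  have QS: "Q (mat_sum d Ms) = (\<Sum>M\<leftarrow>Ms. Q M)" if "set Ms \<subseteq> carrier_mat d d" for Ms
    using that
  proof (induction Ms)
    case (Cons M Ms)
    then have "Q (M + mat_sum d Ms) = Q M + Q (mat_sum d Ms)"
      by (simp add: Q_def distrib_left distrib_right sum.distrib)
    with Cons show ?case by simp
  qed (simp add: Q_def)
  have QK: "Q (mat_adjoint K * K) = complex_of_real (\<Sum>r<dim_row K. (cmod (\<Sum>c<d. K $$ (r, c)
      * x c))\<^sup>2)"
    if "dim_col K = d" for K
  proof -
    have "Q (mat_adjoint K * K)
      = (\<Sum>c<d. \<Sum>e<d. \<Sum>r<dim_row K. cnj (K $$ (r, c) * x c) * (K $$ (r, e) * x e))"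
      unfolding Q_def using that
      by (intro sum.cong refl)
        (auto simp: scalar_prod_def atLeast0LessThan sum_distrib_left sum_distrib_right mult_ac)
    also have "\<dots> = (\<Sum>c<d. \<Sum>r<dim_row K. \<Sum>e<d. cnj (K $$ (r, c) * x c) * (K $$ (r, e) * x e))"
      by (intro sum.cong refl sum.swap)
    also have "\<dots> = (\<Sum>r<dim_row K. \<Sum>c<d. \<Sum>e<d. cnj (K $$ (r, c) * x c) * (K $$ (r, e) * x e))"
      by (rule sum.swap)
    also have "\<dots> = complex_of_real (\<Sum>r<dim_row K. (cmod (\<Sum>c<d. K $$ (r, c) * x c))\<^sup>2)"
      by (simp only: of_real_sum sq cnj_sum sum_product)
    finally show ?thesis .
  qed
  have "complex_of_real (\<Sum>K\<leftarrow>Ls. \<Sum>r<dim_row K. (cmod (\<Sum>c<d. K $$ (r, c) * x c))\<^sup>2)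
      = (\<Sum>K\<leftarrow>Ls. Q (mat_adjoint K * K))" if "\<forall>K\<in>set Ls. dim_col K = d" for Ls
    using that by (induction Ls) (simp_all add: QK)
  then have "complex_of_real (\<Sum>K\<leftarrow>Ks. \<Sum>r<dim_row K. (cmod (\<Sum>c<d. K $$ (r, c) * x c))\<^sup>2)
      = (\<Sum>K\<leftarrow>Ks. Q (mat_adjoint K * K))"
    using assms unfolding complete_def by blast
  also have "\<dots> = Q (mat_sum d (map (\<lambda>K. mat_adjoint K * K) Ks))"
    using assms unfolding complete_def
    by (subst QS) (auto simp: o_def intro!: mult_carrier_mat[of _ _ "dim_row _"])
  also have "\<dots> = (\<Sum>c<d. \<Sum>e<d. if c = e then cnj (x c) * x e else 0)"
    unfolding Q_def conjunct2[OF assms[unfolded complete_def]] by (intro sum.cong refl) auto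
  also have "\<dots> = complex_of_real (\<Sum>c<d. (cmod (x c))\<^sup>2)"
    by (simp only: of_real_sum sq) simp
  finally show ?thesis by (simp only: of_real_eq_iff)
qed

lemma sum_list_sum_swap:
  "(\<Sum>K\<leftarrow>Ks. \<Sum>b\<in>B. f K b) = (\<Sum>b\<in>B. \<Sum>K\<leftarrow>Ks. f K b :: 'a :: comm_monoid_add)"
  by (induction Ks) (auto simp: sum.distrib)

lemma sqnorm_act:
  assumes "complete dA Ks"
  shows "(\<Sum>K\<leftarrow>Ks. sqnorm (dim_row K) dB (act K M)) = sqnorm dA dB M"
proof -
  have "(\<Sum>K\<leftarrow>Ks. sqnorm (dim_row K) dB (act K M))
    = (\<Sum>K\<leftarrow>Ks. \<Sum>b<dB. \<Sum>r<dim_row K. (cmod (\<Sum>c<dA. K $$ (r, c) * M c b))\<^sup>2)"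
    using assms unfolding complete_def sqnorm_def act_def
    by (intro arg_cong[where f = sum_list] map_cong refl) (subst sum.swap, simp)
  also have "\<dots> = (\<Sum>b<dB. \<Sum>a<dA. (cmod (M a b))\<^sup>2)"
    by (simp add: sum_list_sum_swap complete_sum_norm[OF assms])
  also have "\<dots> = sqnorm dA dB M" unfolding sqnorm_def by (rule sum.swap)
  finally show ?thesis .
qed

text \<open>The operators touch only the row index, so the same \<open>w\<close> is a legitimate
  test vector for every \<open>act K M\<close>. Bounding each pair \<open>u\<close>,
  \<open>w\<close> separately makes it unnecessary to know that the supremum is attained.\<close>

lemma top_schmidt_act:
  assumes "complete dA Ks"
  shows "top_schmidt dA dB M \<le> (\<Sum>K\<leftarrow>Ks. top_schmidt (dim_row K) dB (act K M))"
proof (rule top_schmidt_le)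
  fix u w assume uw: "subunit dA u" "subunit dB w"
  define x where "x = (\<lambda>a. \<Sum>b<dB. M a b * w b)"
  have K: "(\<Sum>r<dim_row K. (cmod (\<Sum>c<dA. K $$ (r, c) * x c))\<^sup>2)
      \<le> top_schmidt (dim_row K) dB (act K M)" if "K \<in> set Ks" for K
  proof -
    have "(\<Sum>c<dA. K $$ (r, c) * x c) = (\<Sum>b<dB. act K M r b * w b)" for r
      using assms that unfolding complete_def act_def x_def
      by (simp add: sum_distrib_left sum_distrib_right mult_ac) (subst sum.swap, simp)
    with sum_norm_le_top_schmidt[OF uw(2), of "act K M" "dim_row K"] show ?thesis by simp
  qed
  have "overlap dA dB M u w \<le> (\<Sum>c<dA. (cmod (x c))\<^sup>2)"
    unfolding x_def by (rule overlap_le[OF uw(1)])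
  also have "\<dots> = (\<Sum>K\<leftarrow>Ks. \<Sum>r<dim_row K. (cmod (\<Sum>c<dA. K $$ (r, c) * x c))\<^sup>2)"
    by (rule complete_sum_norm[OF assms, symmetric])
  also have "\<dots> \<le> (\<Sum>K\<leftarrow>Ks. top_schmidt (dim_row K) dB (act K M))"
    by (intro sum_list_mono K)
  finally show "overlap dA dB M u w \<le> (\<Sum>K\<leftarrow>Ks. top_schmidt (dim_row K) dB (act K M))" .
qed

lemma sqnorm_cong:
  assumes "\<And>a b. a < dA \<Longrightarrow> b < dB \<Longrightarrow> M a b = N a b"
  shows "sqnorm dA dB M = sqnorm dA dB N"
  using assms by (simp add: sqnorm_def)

lemma top_schmidt_cong:
  assumes "\<And>a b. a < dA \<Longrightarrow> b < dB \<Longrightarrow> M a b = N a b"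
  shows "top_schmidt dA dB M = top_schmidt dA dB N"
proof -
  have "overlap dA dB M u w = overlap dA dB N u w" for u w
    using assms by (simp add: overlap_def)
  then show ?thesis by (simp add: top_schmidt_def)
qed

text \<open>For a unit vector this is \<open>min 1 (2 * (1 - t))\<close> with \<open>t\<close> the
  top squared Schmidt coefficient, the shape of both formulas to be proved.\<close>

definition potential :: "nat \<Rightarrow> nat \<Rightarrow> (nat \<Rightarrow> nat \<Rightarrow> complex) \<Rightarrow> real" where
  "potential dA dB M
    = min (sqnorm dA dB M) (2 * (sqnorm dA dB M - top_schmidt dA dB M))"

lemma potential_cong:
  assumes "\<And>a b. a < dA \<Longrightarrow> b < dB \<Longrightarrow> M a b = N a b"
  shows "potential dA dB M = potential dA dB N"
  using sqnorm_cong[OF assms] top_schmidt_cong[OF assms] by (simp add: potential_def)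

lemma potential_transpose: "potential dB dA (\<lambda>b a. M a b) = potential dA dB M"
  by (simp add: potential_def sqnorm_transpose[of dB dA M] top_schmidt_transpose[of dB dA M])

text \<open>The minimum is bounded by each of its entries, and the two entries are summed
  separately: \<open>sqnorm\<close> is conserved in total and the total of
  \<open>top_schmidt\<close> does not drop.\<close>

lemma potential_act:
  assumes "complete dA Ks"
  shows "(\<Sum>K\<leftarrow>Ks. potential (dim_row K) dB (act K M)) \<le> potential dA dB M"
proof -
  let ?n = "\<lambda>K. sqnorm (dim_row K) dB (act K M)" and ?t = "\<lambda>K. top_schmidt (dim_row K) dB (act K M)"
  have "(\<Sum>K\<leftarrow>Ks. potential (dim_row K) dB (act K M)) \<le> (\<Sum>K\<leftarrow>Ks. ?n K)"
    by (intro sum_list_mono) (simp add: potential_def)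
  moreover have "(\<Sum>K\<leftarrow>Ks. potential (dim_row K) dB (act K M)) \<le> (\<Sum>K\<leftarrow>Ks. 2 * (?n K - ?t K))"
    by (intro sum_list_mono) (simp add: potential_def)
  moreover have "(\<Sum>K\<leftarrow>Ks. 2 * (?n K - ?t K)) = 2 * ((\<Sum>K\<leftarrow>Ks. ?n K) - (\<Sum>K\<leftarrow>Ks. ?t K))"
    by (induction Ks) auto
  ultimately show ?thesis
    using sqnorm_act[OF assms, of dB M] top_schmidt_act[OF assms, of dB M]
    by (simp add: potential_def)
qed

lemma block_index:
  fixes a b m n :: nat
  assumes "a < m" "b < n"
  shows "a * n + b < m * n" "(a * n + b) div n = a" "(a * n + b) mod n = b"
proof -
  have "a * n + b < Suc a * n" using assms by simp
  also have "\<dots> \<le> m * n" using assms by (intro mult_le_mono) auto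
  finally show "a * n + b < m * n" .
qed (use assms in auto)

section \<open>Local operators on amplitude matrices\<close>

lemma amp_alice:
  assumes "dim_col K = dA" "v \<in> carrier_vec (dA * dB)" "a < dim_row K" "b < dB"
  shows "amp dB (kron K (1\<^sub>m dB) *\<^sub>v v) a b = act K (amp dB v) a b"
proof -
  have "amp dB (kron K (1\<^sub>m dB) *\<^sub>v v) a b
      = (\<Sum>k<dA * dB. K $$ (a, k div dB) * (1\<^sub>m dB) $$ (b, k mod dB) * v $ k)"
    using assms block_index[of a "dim_row K" b dB]
    by (auto simp: amp_def scalar_prod_def kron_def atLeast0LessThan intro!: sum.cong)
  also have "\<dots> = (\<Sum>c<dA. \<Sum>e<dB. K $$ (a, c) * (if b = e then 1 else 0) * v $ (c * dB + e))"
    unfolding sum_mult_block using assms by (intro sum.cong refl) auto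
  also have "\<dots> = act K (amp dB v) a b"
    using assms by (auto simp: act_def amp_def if_distrib[of "\<lambda>x. _ * x * _"] cong: if_cong
        intro!: sum.cong)
  finally show ?thesis .
qed

text \<open>Bob's operator multiplies the amplitude matrix from the right by the plain transpose of
  \<open>K\<close>, without conjugation, so it is a left action on the transposed matrix.\<close>

lemma amp_bob:
  assumes "dim_col K = dB" "v \<in> carrier_vec (dA * dB)" "a < dA" "b < dim_row K"
  shows "amp (dim_row K) (kron (1\<^sub>m dA) K *\<^sub>v v) a b = act K (\<lambda>b a. amp dB v a b) b a"
proof -
  have "amp (dim_row K) (kron (1\<^sub>m dA) K *\<^sub>v v) a b
      = (\<Sum>k<dA * dB. (1\<^sub>m dA) $$ (a, k div dB) * K $$ (b, k mod dB) * v $ k)"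
    using assms block_index[of a dA b "dim_row K"]
    by (auto simp: amp_def scalar_prod_def kron_def atLeast0LessThan intro!: sum.cong)
  also have "\<dots> = (\<Sum>c<dA. \<Sum>e<dB. (if a = c then 1 else 0) * (K $$ (b, e) * v $ (c * dB + e)))"
    unfolding sum_mult_block using assms by (intro sum.cong refl) auto
  also have "\<dots> = (\<Sum>c<dA. if a = c then \<Sum>e<dB. K $$ (b, e) * v $ (c * dB + e) else 0)"
    by (intro sum.cong refl) auto
  also have "\<dots> = act K (\<lambda>b a. amp dB v a b) b a"
    using assms by (simp add: act_def amp_def)
  finally show ?thesis .
qed

lemma mat_trace_ensemble:
  assumes "set vs \<subseteq> carrier_vec (dA * dB)"
  shows "mat_trace (ensemble (dA * dB) vs) = complex_of_real (\<Sum>v\<leftarrow>vs. sqnorm dA dB (amp dB v))"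
proof -
  have "dim_row (ensemble (dA * dB) vs) = dA * dB"
    unfolding ensemble_def using assms by (intro carrier_matD(1)[OF mat_sum_carrier]) auto
  then have "mat_trace (ensemble (dA * dB) vs) = (\<Sum>i<dA * dB. \<Sum>v\<leftarrow>vs. v $ i * cnj (v $ i))"
    unfolding mat_trace_def by (intro sum.cong) (simp_all add: ensemble_index[OF assms])
  also have "\<dots> = (\<Sum>v\<leftarrow>vs. \<Sum>i<dA * dB. v $ i * cnj (v $ i))"
    by (rule sum_list_sum_swap[symmetric])
  also have "\<dots> = (\<Sum>v\<leftarrow>vs. complex_of_real (sqnorm dA dB (amp dB v)))"
    by (simp only: sum_mult_block sqnorm_def amp_def of_real_sum complex_norm_square)
  also have "\<dots> = complex_of_real (\<Sum>v\<leftarrow>vs. sqnorm dA dB (amp dB v))"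
    by (induction vs) auto
  finally show ?thesis .
qed

section \<open>Shape of the states that contain a Bell pair\<close>

lemma proj_bell_index:
  assumes "i < 4" "j < 4"
  shows "proj bell $$ (i, j) = (if i \<in> {0, 3} \<and> j \<in> {0, 3} then 1 / 2 else 0)"
proof -
  have bell: "bell = complex_of_real (1 / sqrt 2) \<cdot>\<^sub>v (unit_vec 4 0 + unit_vec 4 3)"
    by (simp add: bell_def ket_def bits_index_def)
  have "bell $ k = (if k \<in> {0, 3} then 1 / complex_of_real (sqrt 2) else 0)" if "k < 4" for k
    unfolding bell using that by (auto simp: unit_vec_def)
  moreover have "dim_vec bell = 4"
    by (simp add: bell_def ket_def)
  moreover have "complex_of_real (sqrt 2) * complex_of_real (sqrt 2) = 2"
    by (metis of_real_mult of_real_numeral real_sqrt_mult_self abs_numeral)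
  ultimately show ?thesis using assms
    by (auto simp: proj_def)
qed

lemma sum_double:
  fixes f :: "nat \<Rightarrow> 'a :: comm_monoid_add"
  shows "(\<Sum>k<2 * n. f k) = (\<Sum>b<n. f b) + (\<Sum>b<n. f (n + b))"
  using sum_mult_block[of f 2 n] by (simp add: sum_lessThan_2)

lemma reduced_AB_ensemble:
  assumes "set vs \<subseteq> carrier_vec ((2 * m) * (2 * n))" "i < 4" "j < 4"
  shows "reduced_AB m n (ensemble ((2 * m) * (2 * n)) vs) $$ (i, j)
    = (\<Sum>v\<leftarrow>vs. \<Sum>x<m. \<Sum>y<n. amp (2 * n) v (i div 2 * m + x) (i mod 2 * n + y)
        * cnj (amp (2 * n) v (j div 2 * m + x) (j mod 2 * n + y)))"
proof -
  have idx: "(i div 2 * m + x) * (2 * n) + (i mod 2 * n + y) < (2 * m) * (2 * n)"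
    if "i < 4" "x < m" "y < n" for i x y
  proof -
    have "i div 2 < 2" "i mod 2 < 2" using that by auto
    then show ?thesis using that by (intro block_index(1)) auto
  qed
  show ?thesis
    using assms idx
    by (auto simp: reduced_AB_def amp_def ensemble_index sum_list_sum_swap intro!: sum.cong)
qed

text \<open>A multiple of the Bell projector has expectation 0 in |01>, |10> and |00> - |11>. Each
  expectation is a sum of squared moduli over all members and all indices of the traced-out systems,
  so every single term vanishes.\<close>

lemma bell_restored_blocks:
  assumes vs: "set vs \<subseteq> carrier_vec ((2 * m) * (2 * n))"
    and bell: "bell_restored (2 * m) (2 * n) (ensemble ((2 * m) * (2 * n)) vs)"
    and v: "v \<in> set vs" and x: "x < m" and y: "y < n"
  shows "amp (2 * n) v x (n + y) = 0" "amp (2 * n) v (m + x) y = 0"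
    "amp (2 * n) v (m + x) (n + y) = amp (2 * n) v x y"
proof -
  define \<rho> where "\<rho> = ensemble ((2 * m) * (2 * n)) vs"
  define r where "r = (\<lambda>i j. reduced_AB m n \<rho> $$ (i, j))"
  have r: "r i j = mat_trace \<rho> * proj bell $$ (i, j)" if "i < 4" "j < 4" for i j
  proof -
    have "reduced_AB m n \<rho> = mat_trace \<rho> \<cdot>\<^sub>m proj bell"
      using bell by (simp add: bell_restored_def \<rho>_def)
    moreover have "proj bell \<in> carrier_mat 4 4"
      by (simp add: proj_def bell_def ket_def)
    ultimately show ?thesis using that by (simp add: r_def)
  qed
  have zero: "f v x y = 0" if "(\<Sum>v\<leftarrow>vs. \<Sum>x<m. \<Sum>y<n. f v x y * cnj (f v x y)) = 0"
    for f :: "complex vec \<Rightarrow> nat \<Rightarrow> nat \<Rightarrow> complex"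
  proof -
    have "complex_of_real (\<Sum>v\<leftarrow>vs. \<Sum>x<m. \<Sum>y<n. (cmod (f v x y))\<^sup>2)
        = (\<Sum>v\<leftarrow>vs. \<Sum>x<m. \<Sum>y<n. f v x y * cnj (f v x y))"
      by (induction vs) (simp_all only: list.map sum_list_simps of_real_add of_real_sum
          complex_norm_square of_real_0)
    with that have "(\<Sum>v\<leftarrow>vs. \<Sum>x<m. \<Sum>y<n. (cmod (f v x y))\<^sup>2) = 0"
      by (simp only: of_real_eq_0_iff)
    then have "(\<Sum>x<m. \<Sum>y<n. (cmod (f v x y))\<^sup>2) = 0"
      using v by (subst (asm) sum_list_nonneg_eq_0_iff) (auto intro!: sum_nonneg)
    then have "(\<Sum>y<n. (cmod (f v x y))\<^sup>2) = 0"
      using x by (subst (asm) sum_nonneg_eq_0_iff) (auto intro!: sum_nonneg)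
    then show ?thesis
      using y by (subst (asm) sum_nonneg_eq_0_iff) auto
  qed
  note red = reduced_AB_ensemble[OF vs, folded \<rho>_def r_def]
  \<comment> \<open>The expectations in |01>, |10> and, without normalisation, |00> - |11>.\<close>
  have "r 1 1 = 0" "r 2 2 = 0" "r 0 0 - r 0 3 - r 3 0 + r 3 3 = 0"
    by (simp_all add: r proj_bell_index)
  then have "(\<Sum>v\<leftarrow>vs. \<Sum>x<m. \<Sum>y<n. amp (2 * n) v x (n + y) * cnj (amp (2 * n) v x (n + y))) = 0"
    and "(\<Sum>v\<leftarrow>vs. \<Sum>x<m. \<Sum>y<n. amp (2 * n) v (m + x) y * cnj (amp (2 * n) v (m + x) y)) = 0"
    and *: "r 0 0 - r 0 3 - r 3 0 + r 3 3 = 0"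
    using red[of 1 1] red[of 2 2] by (simp_all add: r_def)
  from zero[OF this(1)] zero[OF this(2)]
  show "amp (2 * n) v x (n + y) = 0" "amp (2 * n) v (m + x) y = 0" .
  have "(\<Sum>v\<leftarrow>vs. \<Sum>x<m. \<Sum>y<n. (amp (2 * n) v (m + x) (n + y) - amp (2 * n) v x y)
      * cnj (amp (2 * n) v (m + x) (n + y) - amp (2 * n) v x y)) = r 0 0 - r 0 3 - r 3 0 + r 3 3"
    using red[of 0 0] red[of 0 3] red[of 3 0] red[of 3 3]
    by (simp add: r_def sum_subtractf sum.distrib algebra_simps flip: sum_list_addf
        sum_list_subtractf)
  with * zero[of "\<lambda>v x y. amp (2 * n) v (m + x) (n + y) - amp (2 * n) v x y"]
  show "amp (2 * n) v (m + x) (n + y) = amp (2 * n) v x y" by simp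
qed

lemma cmod_two_le:
  "(cmod (p * q + p' * q'))\<^sup>2
    \<le> ((cmod p)\<^sup>2 + (cmod p')\<^sup>2) * ((cmod q)\<^sup>2 + (cmod q')\<^sup>2)"
  using cmod_sum_mult_le[of "case_bool p p'" "case_bool q q'" UNIV]
  by (simp add: UNIV_bool add.commute)

text \<open>Here \<open>M\<close> is a direct sum of two copies of one block. With \<open>u\<close>
  and \<open>w\<close> cut into halves, the form equals the entrywise pairing of that block with the
  sum of the two outer products of halves, called \<open>g\<close>. The Hilbert-Schmidt norm of
  \<open>g\<close> is at most 1, so Cauchy-Schwarz bounds the overlap by the squared norm of one
  block, half of the total.\<close>

lemma top_schmidt_blocks:
  assumes M: "\<And>x y. x < m \<Longrightarrow> y < n \<Longrightarrow> M x (n + y) = 0"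
    "\<And>x y. x < m \<Longrightarrow> y < n \<Longrightarrow> M (m + x) y = 0"
    "\<And>x y. x < m \<Longrightarrow> y < n \<Longrightarrow> M (m + x) (n + y) = M x y"
  shows "2 * top_schmidt (2 * m) (2 * n) M \<le> sqnorm (2 * m) (2 * n) M"
proof -
  have norm: "sqnorm (2 * m) (2 * n) M = 2 * sqnorm m n M"
    by (simp add: sqnorm_def sum_double M sum.distrib)
  have "top_schmidt (2 * m) (2 * n) M \<le> sqnorm m n M"
  proof (rule top_schmidt_le)
    fix u w assume uw: "subunit (2 * m) u" "subunit (2 * n) w"
    define g where "g = (\<lambda>(x, y). u x * w y + u (m + x) * w (n + y))"
    have "(\<Sum>a<2 * m. u a * (\<Sum>b<2 * n. M a b * w b))
        = (\<Sum>x<m. u x * (\<Sum>y<n. M x y * w y)) + (\<Sum>x<m. u (m + x) * (\<Sum>y<n. M x y * w (n + y)))"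
      by (simp add: sum_double M)
    also have "\<dots> = (\<Sum>x<m. \<Sum>y<n. M x y * g (x, y))"
      by (simp add: g_def sum_distrib_left distrib_left sum.distrib mult_ac)
    also have "\<dots> = (\<Sum>z\<in>{..<m} \<times> {..<n}. M (fst z) (snd z) * g z)"
      by (simp add: sum.cartesian_product case_prod_unfold)
    finally have "overlap (2 * m) (2 * n) M u w
        \<le> (\<Sum>z\<in>{..<m} \<times> {..<n}. (cmod (M (fst z) (snd z)))\<^sup>2) * (\<Sum>z\<in>{..<m} \<times> {..<n}. (cmod (g z))\<^sup>2)"
      unfolding overlap_def by (simp only: cmod_sum_mult_le)
    also have "(\<Sum>z\<in>{..<m} \<times> {..<n}. (cmod (M (fst z) (snd z)))\<^sup>2) = sqnorm m n M"
      by (simp add: sqnorm_def sum.cartesian_product case_prod_unfold)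
    finally have le: "overlap (2 * m) (2 * n) M u w
      \<le> sqnorm m n M * (\<Sum>z\<in>{..<m} \<times> {..<n}. (cmod (g z))\<^sup>2)" .
    have "(\<Sum>z\<in>{..<m} \<times> {..<n}. (cmod (g z))\<^sup>2)
      \<le> (\<Sum>x<m. \<Sum>y<n. ((cmod (u x))\<^sup>2 + (cmod (u (m + x)))\<^sup>2) * ((cmod (w y))\<^sup>2 + (cmod (w (n
          + y)))\<^sup>2))"
      unfolding sum.cartesian_product by (intro sum_mono) (auto simp: g_def cmod_two_le)
    also have "\<dots> = (\<Sum>x<m. (cmod (u x))\<^sup>2 + (cmod (u (m + x)))\<^sup>2)
        * (\<Sum>y<n. (cmod (w y))\<^sup>2 + (cmod (w (n + y)))\<^sup>2)"
      by (simp only: sum_product)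
    also have "\<dots> = (\<Sum>a<2 * m. (cmod (u a))\<^sup>2) * (\<Sum>b<2 * n. (cmod (w b))\<^sup>2)"
      by (simp add: sum_double sum.distrib)
    also have "\<dots> \<le> 1 * 1"
      using uw unfolding subunit_def by (intro mult_mono sum_nonneg) auto
    finally have "sqnorm m n M * (\<Sum>z\<in>{..<m} \<times> {..<n}. (cmod (g z))\<^sup>2) \<le> sqnorm m n M * 1"
      by (intro mult_left_mono) (auto simp: sqnorm_def intro!: sum_nonneg)
    with le show "overlap (2 * m) (2 * n) M u w \<le> sqnorm m n M" by simp
  qed
  with norm show ?thesis by simp
qed

lemma top_schmidt_le_sqnorm: "top_schmidt dA dB M \<le> sqnorm dA dB M"
  by (intro top_schmidt_le overlap_le_sqnorm)

lemma sqnorm_nonneg: "0 \<le> sqnorm dA dB M"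
  by (auto simp: sqnorm_def intro!: sum_nonneg)

section \<open>Bounds for arbitrary protocols\<close>

lemma instrument_complete:
  assumes "is_instrument d I"
  shows "complete d (concat (map (kraus I) [0..<outcomes I]))"
  using assms by (fastforce simp: is_instrument_def complete_def)

lemma sum_list_concat_map:
  fixes f :: "'b \<Rightarrow> 'c :: comm_monoid_add"
  shows "(\<Sum>x\<leftarrow>concat (map g xs). f x) = (\<Sum>i\<leftarrow>xs. \<Sum>x\<leftarrow>g i. f x)"
  by (induction xs) auto

text \<open>Dimensions and ensemble are generalised because every round changes both. At a
  successful leaf the block form makes the potential of each member equal to its probability; at any
  other leaf it is enough that the potential is nonnegative.\<close>

lemma restoring_prob_le_potential:
  assumes "is_protocol P dA dB" "set vs \<subseteq> carrier_vec (dA * dB)"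
  shows "restoring_prob P dA dB (ensemble (dA * dB) vs) \<le> (\<Sum>v\<leftarrow>vs. potential dA dB (amp dB v))"
  using assms
proof (induction P arbitrary: dA dB vs)
  case Stop
  show ?case
  proof (cases "bell_restored dA dB (ensemble (dA * dB) vs)")
    case True
    then obtain m n where dims: "dA = 2 * m" "dB = 2 * n"
      by (auto simp: bell_restored_def elim!: evenE)
    have "potential dA dB (amp dB v) = sqnorm dA dB (amp dB v)" if "v \<in> set vs" for v
    proof -
      have "2 * top_schmidt dA dB (amp dB v) \<le> sqnorm dA dB (amp dB v)"
        unfolding dims using bell_restored_blocks[OF Stop(2)[unfolded dims] True[unfolded dims]
            that]
        by (intro top_schmidt_blocks) auto
      then show ?thesis by (simp add: potential_def)
    qed
    then have "(\<Sum>v\<leftarrow>vs. potential dA dB (amp dB v)) = (\<Sum>v\<leftarrow>vs. sqnorm dA dB (amp dB v))"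
      by (intro arg_cong[where f = sum_list] map_cong) auto
    with True Stop show ?thesis by (simp add: mat_trace_ensemble)
  next
    case False
    have "0 \<le> potential dA dB (amp dB v)" for v
      using top_schmidt_le_sqnorm sqnorm_nonneg by (simp add: potential_def)
    with False show ?thesis by (auto intro!: sum_list_nonneg)
  qed
next
  case (Alice_Op I Q)
  then have I: "is_instrument dA I" by simp
  note Ks = instrument_complete[OF I]
  have "restoring_prob (Alice_Op I Q) dA dB (ensemble (dA * dB) vs)
      \<le> (\<Sum>i<outcomes I. \<Sum>v\<leftarrow>after_alice dB (kraus I i) vs. potential (out_dim I i) dB (amp dB v))"
    using Alice_Op.prems after_alice_carrier[OF I _ Alice_Op.prems(2)]
    by (auto simp: alice_map_ensemble intro!: sum_mono Alice_Op.IH)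
  also have "\<dots> = (\<Sum>i<outcomes I. \<Sum>K\<leftarrow>kraus I i. \<Sum>v\<leftarrow>vs. potential (dim_row K) dB (act K (amp dB v)))"
  proof (intro sum.cong refl)
    fix i assume "i \<in> {..<outcomes I}"
    then have "dim_row K = out_dim I i" "dim_col K = dA" if "K \<in> set (kraus I i)" for K
      using I that by (auto simp: is_instrument_def)
    moreover from this have "amp dB (kron K (1\<^sub>m dB) *\<^sub>v v) a b = act K (amp dB v) a b"
      if "K \<in> set (kraus I i)" "v \<in> set vs" "a < out_dim I i" "b < dB" for K v a b
      using that Alice_Op.prems(2) by (intro amp_alice[of K dA]) auto
    ultimately show "(\<Sum>v\<leftarrow>after_alice dB (kraus I i) vs. potential (out_dim I i) dB (amp dB v))
      = (\<Sum>K\<leftarrow>kraus I i. \<Sum>v\<leftarrow>vs. potential (dim_row K) dB (act K (amp dB v)))"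
      using Alice_Op.prems(2) unfolding after_alice_def sum_list_concat_map
      by (auto simp: o_def intro!: arg_cong[where f = sum_list] map_cong potential_cong)
  qed
  \<comment> \<open>Completeness holds only for the operators of all outcomes together, so the
    outcomes are merged before the monotonicity is applied to each member.\<close>
  also have "\<dots> = (\<Sum>K\<leftarrow>concat (map (kraus I) [0..<outcomes I]). \<Sum>v\<leftarrow>vs. potential (dim_row K) dB (act
      K (amp dB v)))"
    unfolding sum_list_concat_map by (simp add: interv_sum_list_conv_sum_set_nat atLeast0LessThan)
  also have "\<dots> = (\<Sum>v\<leftarrow>vs. \<Sum>K\<leftarrow>concat (map (kraus I) [0..<outcomes I]). potential (dim_row K) dB (act
      K (amp dB v)))"
    by (induction vs) (simp_all add: sum_list_addf)
  also have "\<dots> \<le> (\<Sum>v\<leftarrow>vs. potential dA dB (amp dB v))"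
    by (intro sum_list_mono potential_act Ks)
  finally show ?case .
next
  case (Bob_Op I Q)
  then have I: "is_instrument dB I" by simp
  note Ks = instrument_complete[OF I]
  \<comment> \<open>A round of Bob is a round of Alice on the transposed matrix, and
    \<open>potential\<close> is invariant under transposition.\<close>
  let ?ampT = "\<lambda>v b a. amp dB v a b"
  have "restoring_prob (Bob_Op I Q) dA dB (ensemble (dA * dB) vs)
      \<le> (\<Sum>i<outcomes I. \<Sum>v\<leftarrow>after_bob dA (kraus I i) vs. potential dA (out_dim I i) (amp (out_dim I
          i) v))"
    using Bob_Op.prems after_bob_carrier[OF I _ Bob_Op.prems(2)]
    by (auto simp: bob_map_ensemble intro!: sum_mono Bob_Op.IH)
  also have "\<dots> = (\<Sum>i<outcomes I. \<Sum>K\<leftarrow>kraus I i. \<Sum>v\<leftarrow>vs. potential (dim_row K) dA (act K (?ampT v)))"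
  proof (intro sum.cong refl)
    fix i assume "i \<in> {..<outcomes I}"
    then have "dim_row K = out_dim I i" "dim_col K = dB" if "K \<in> set (kraus I i)" for K
      using I that by (auto simp: is_instrument_def)
    moreover from this have "amp (out_dim I i) (kron (1\<^sub>m dA) K *\<^sub>v v) a b
        = act K (\<lambda>b a. amp dB v a b) b a"
      if "K \<in> set (kraus I i)" "v \<in> set vs" "a < dA" "b < out_dim I i" for K v a b
      using that Bob_Op.prems(2) amp_bob[of K dB v dA a b] by auto
    ultimately show "(\<Sum>v\<leftarrow>after_bob dA (kraus I i) vs. potential dA (out_dim I i) (amp (out_dim I
        i) v))
      = (\<Sum>K\<leftarrow>kraus I i. \<Sum>v\<leftarrow>vs. potential (dim_row K) dA (act K (?ampT v)))"
      using Bob_Op.prems(2) unfolding after_bob_def sum_list_concat_map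
      by (subst potential_transpose[symmetric])
        (auto simp: o_def intro!: arg_cong[where f = sum_list] map_cong potential_cong)
  qed
  also have "\<dots> = (\<Sum>K\<leftarrow>concat (map (kraus I) [0..<outcomes I]). \<Sum>v\<leftarrow>vs. potential (dim_row K) dA (act
      K (?ampT v)))"
    unfolding sum_list_concat_map by (simp add: interv_sum_list_conv_sum_set_nat atLeast0LessThan)
  also have "\<dots> = (\<Sum>v\<leftarrow>vs. \<Sum>K\<leftarrow>concat (map (kraus I) [0..<outcomes I]). potential (dim_row K) dA (act
      K (?ampT v)))"
    by (induction vs) (simp_all add: sum_list_addf)
  also have "\<dots> \<le> (\<Sum>v\<leftarrow>vs. potential dB dA (?ampT v))"
    by (intro sum_list_mono potential_act Ks)
  also have "\<dots> = (\<Sum>v\<leftarrow>vs. potential dA dB (amp dB v))"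
    by (intro arg_cong[where f = sum_list] map_cong refl potential_transpose)
  finally show ?case .
qed

text \<open>In lower bounds this allows outcomes that are not meant to succeed to be dropped without
  evaluating them.\<close>

lemma restoring_prob_nonneg:
  assumes "is_protocol P dA dB" "set vs \<subseteq> carrier_vec (dA * dB)"
  shows "0 \<le> restoring_prob P dA dB (ensemble (dA * dB) vs)"
  using assms
proof (induction P arbitrary: dA dB vs)
  case Stop
  then show ?case
    by (auto simp: mat_trace_ensemble sqnorm_nonneg intro!: sum_list_nonneg)
next
  case (Alice_Op I Q)
  then have I: "is_instrument dA I" by simp
  show ?case
    using Alice_Op.prems after_alice_carrier[OF I _ Alice_Op.prems(2)]
    by (auto simp: alice_map_ensemble intro!: sum_nonneg Alice_Op.IH)
next
  case (Bob_Op I Q)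
  then have I: "is_instrument dB I" by simp
  show ?case
    using Bob_Op.prems after_bob_carrier[OF I _ Bob_Op.prems(2)]
    by (auto simp: bob_map_ensemble intro!: sum_nonneg Bob_Op.IH)
qed

section \<open>Optimal protocols for states in Schmidt form\<close>

definition real_rows :: "nat \<Rightarrow> (nat \<Rightarrow> real) list \<Rightarrow> complex mat" where
  "real_rows d rs = mat (length rs) d (\<lambda>(r, c). complex_of_real ((rs ! r) c))"

lemma real_rows_dim [simp]:
  "dim_row (real_rows d rs) = length rs" "dim_col (real_rows d rs) = d"
  "real_rows d rs \<in> carrier_mat (length rs) d"
  by (auto simp: real_rows_def)

text \<open>The three levels of \<open>L\<close> are outcomes, Kraus operators of an outcome, and
  rows of an operator; the output dimension is read off the first operator of the outcome.\<close>

definition real_instrument :: "nat \<Rightarrow> (nat \<Rightarrow> real) list list list \<Rightarrow> instrument" where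
  "real_instrument d L = Instrument (length L) (\<lambda>i. length (hd (L ! i))) (\<lambda>i. map (real_rows d) (L
      ! i))"

text \<open>The product of the adjoint of a matrix with the matrix is the sum of the outer squares
  of its rows. Completeness therefore depends only on the collection of all rows, not on how they
  are grouped.\<close>

lemma is_instrument_real:
  assumes len: "\<And>Rs. Rs \<in> set L \<Longrightarrow> Rs \<noteq> [] \<and> hd Rs \<noteq> []"
    "\<And>Rs rs. Rs \<in> set L \<Longrightarrow> rs \<in> set Rs \<Longrightarrow> length rs = length (hd Rs)"
    and sum: "\<And>c e. c < d \<Longrightarrow> e < d \<Longrightarrow>
      (\<Sum>r\<leftarrow>concat (concat L). r c * r e) = (if c = e then 1 else 0)"
  shows "is_instrument d (real_instrument d L)"
proof -
  have "set (map (real_rows d) (L ! i)) \<subseteq> carrier_mat (length (hd (L ! i))) d"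
      "0 < length (hd (L ! i))"
    if "i < length L" for i
  proof -
    have mem: "L ! i \<in> set L" using that by simp
    then show "0 < length (hd (L ! i))" using len(1) by simp
    show "set (map (real_rows d) (L ! i)) \<subseteq> carrier_mat (length (hd (L ! i))) d"
    proof
      fix K assume "K \<in> set (map (real_rows d) (L ! i))"
      then obtain rs where rs: "K = real_rows d rs" "rs \<in> set (L ! i)" by auto
      show "K \<in> carrier_mat (length (hd (L ! i))) d"
        unfolding rs(1) len(2)[OF mem rs(2), symmetric] by simp
    qed
  qed
  moreover have "map (\<lambda>i. map (real_rows d) (L ! i)) [0..<length L] = map (map (real_rows d)) L"
    by (intro nth_equalityI) simp_all
  then have "concat (map (\<lambda>i. map (real_rows d) (L ! i)) [0..<length L])
      = map (real_rows d) (concat L)"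
    by (simp add: map_concat)
  moreover have "mat_sum d (map (\<lambda>K. mat_adjoint K * K) (map (real_rows d) (concat L)))
      = 1\<^sub>m d" (is "mat_sum d ?Ms = _")
  proof -
    have Ms: "set ?Ms \<subseteq> carrier_mat d d" by auto
    show ?thesis
    proof (rule eq_matI)
      fix c e assume "c < dim_row (1\<^sub>m d)" "e < dim_col (1\<^sub>m d)"
      then have ce: "c < d" "e < d" by auto
      have K: "(mat_adjoint (real_rows d rs) * real_rows d rs) $$ (c, e)
          = complex_of_real (\<Sum>r\<leftarrow>rs. r c * r e)" for rs
      proof -
        have "(mat_adjoint (real_rows d rs) * real_rows d rs) $$ (c, e)
          = complex_of_real (\<Sum>i<length rs. (rs ! i) c * (rs ! i) e)"
          using ce by (simp add: scalar_prod_def real_rows_def atLeast0LessThan)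
        also have "(\<Sum>i<length rs. (rs ! i) c * (rs ! i) e) = (\<Sum>r\<leftarrow>rs. r c * r e)"
          by (simp add: sum_list_sum_nth atLeast0LessThan)
        finally show ?thesis .
      qed
      have sum_concat: "(\<Sum>rs\<leftarrow>Rss. complex_of_real (\<Sum>r\<leftarrow>rs. r c * r e))
          = complex_of_real (\<Sum>r\<leftarrow>concat Rss. r c * r e)" for Rss
        by (induction Rss) auto
      have "mat_sum d ?Ms $$ (c, e) = (\<Sum>rs\<leftarrow>concat L. complex_of_real (\<Sum>r\<leftarrow>rs. r c * r e))"
        unfolding mat_sum_index[OF Ms ce] by (simp only: map_map o_def K)
      also have "\<dots> = complex_of_real (\<Sum>r\<leftarrow>concat (concat L). r c * r e)"
        by (rule sum_concat)
      finally show "mat_sum d ?Ms $$ (c, e) = 1\<^sub>m d $$ (c, e)"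
        using ce sum by simp
    qed (use carrier_matD[OF mat_sum_carrier[OF Ms]] in auto)
  qed
  ultimately show ?thesis by (simp add: is_instrument_def real_instrument_def)
qed

section \<open>From two equal Schmidt coefficients to a Bell pair\<close>

lemma reduced_AB_qubits:
  assumes "\<rho> \<in> carrier_mat 4 4"
  shows "reduced_AB 1 1 \<rho> = \<rho>"
proof (rule eq_matI)
  fix i j assume "i < dim_row \<rho>" "j < dim_col \<rho>"
  moreover have "i div 2 * 2 + i mod 2 = i" for i :: nat by presburger
  ultimately show "reduced_AB 1 1 \<rho> $$ (i, j) = \<rho> $$ (i, j)"
    using assms by (simp add: reduced_AB_def)
qed (use assms in \<open>auto simp: reduced_AB_def\<close>)

lemma restoring_prob_bell:
  assumes v: "v \<in> carrier_vec 4" and w: "0 \<le> w"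
    and vi: "\<And>k. k < 4 \<Longrightarrow> v $ k = (if k \<in> {0, 3} then complex_of_real (sqrt w) else 0)"
  shows "restoring_prob Stop 2 2 (proj v) = 2 * w"
proof -
  have sq: "complex_of_real (sqrt w) * complex_of_real (sqrt w) = complex_of_real w"
    using w by (metis of_real_mult real_sqrt_mult_self abs_of_nonneg)
  have idx: "proj v $$ (i, j) = (if i \<in> {0, 3} \<and> j \<in> {0, 3} then complex_of_real w else 0)"
    if "i < 4" "j < 4" for i j
    using that v vi sq by (auto simp: proj_def)
  have "mat_trace (proj v) = (\<Sum>i<(4 :: nat). if i \<in> {0, 3} then complex_of_real w else 0)"
    unfolding mat_trace_def using carrier_matD[OF proj_carrier[OF v]]
    by (intro sum.cong) (auto simp: idx)
  also have "\<dots> = 2 * complex_of_real w"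
    by (simp add: sum_lessThan_4)
  finally have tr: "mat_trace (proj v) = 2 * complex_of_real w" .
  have "proj v = mat_trace (proj v) \<cdot>\<^sub>m proj bell"
  proof (rule eq_matI)
    have dim: "dim_row (proj bell) = 4" "dim_col (proj bell) = 4"
      by (simp_all add: proj_def bell_def ket_def)
    then show "dim_row (proj v) = dim_row (mat_trace (proj v) \<cdot>\<^sub>m proj bell)"
      "dim_col (proj v) = dim_col (mat_trace (proj v) \<cdot>\<^sub>m proj bell)"
      using v by (simp_all add: proj_def)
    fix i j assume "i < dim_row (mat_trace (proj v) \<cdot>\<^sub>m proj bell)"
        "j < dim_col (mat_trace (proj v) \<cdot>\<^sub>m proj bell)"
    then have "i < 4" "j < 4" using dim by auto
    then show "proj v $$ (i, j) = (mat_trace (proj v) \<cdot>\<^sub>m proj bell) $$ (i, j)"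
      using dim by (simp add: idx tr proj_bell_index)
  qed
  moreover have "reduced_AB 1 1 (proj v) = proj v"
    by (intro reduced_AB_qubits proj_carrier v)
  ultimately have "bell_restored 2 2 (proj v)"
    by (simp add: bell_restored_def)
  then show ?thesis by (simp add: tr)
qed

text \<open>Alice's qubit is already correlated with two orthonormal vectors of Bob at equal weight.
  Bob maps their span isometrically onto a qubit; the other outcome, made of the complementary rows
  \<open>V k\<close> and \<open>V l\<close>, only completes his instrument and is estimated by
  0.\<close>

lemma bob_completes_bell:
  fixes V :: "nat \<Rightarrow> nat \<Rightarrow> real"
  assumes v: "v \<in> carrier_vec (2 * 4)" and w: "0 \<le> w"
    and amp: "\<And>b. b < 4 \<Longrightarrow> amp 4 v 0 b = complex_of_real (sqrt w * V i b)"
      "\<And>b. b < 4 \<Longrightarrow> amp 4 v 1 b = complex_of_real (sqrt w * V j b)"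
    and rows: "(\<Sum>b<4. V i b * V i b) = 1" "(\<Sum>b<4. V j b * V j b) = 1" "(\<Sum>b<4. V i b * V j b) = 0"
    and cols: "\<And>b c. b < 4 \<Longrightarrow> c < 4 \<Longrightarrow>
      V i b * V i c + V j b * V j c + V k b * V k c + V l b * V l c = (if b = c then 1 else 0)"
    and P: "P = Bob_Op (real_instrument 4 [[[V i, V j]], [[V k], [V l]]]) (\<lambda>_. Stop)"
  shows "is_protocol P 2 4" "2 * w \<le> restoring_prob P 2 4 (proj v)"
proof -
  define I where "I = real_instrument 4 [[[V i, V j]], [[V k], [V l]]]"
  have I: "is_instrument 4 I"
    unfolding I_def by (rule is_instrument_real) (use cols in \<open>auto simp: add.assoc\<close>)
  then show prot: "is_protocol P 2 4" by (simp add: P I_def)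
  define K where "K = real_rows 4 [V i, V j]"
  define v' where "v' = kron (1\<^sub>m 2) K *\<^sub>v v"
  have K: "K \<in> carrier_mat 2 4" unfolding K_def by (intro carrier_matI) simp_all
  have c: "v' \<in> carrier_vec 4"
    using mult_mat_vec_carrier[OF kron_carrier[OF one_carrier_mat K] v] by (simp add: v'_def)
  have "restoring_prob P 2 4 (proj v)
    = restoring_prob Stop 2 (out_dim I 0) (bob_map I 0 2 (proj v))
      + restoring_prob Stop 2 (out_dim I 1) (bob_map I 1 2 (proj v))"
    by (simp add: P I_def real_instrument_def sum_lessThan_2)
  moreover have "0 \<le> restoring_prob Stop 2 (out_dim I 1) (bob_map I 1 2 (proj v))"
  proof -
    have "1 < outcomes I" by (simp add: I_def real_instrument_def)
    then show ?thesis
      using bob_map_ensemble[OF I, of 1 "[v]" 2] after_bob_carrier[OF I, of 1 "[v]" 2] v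
        restoring_prob_nonneg[of Stop 2 "out_dim I 1" "after_bob 2 (kraus I 1) [v]"]
      by (simp add: ensemble_single[of _ 8] del: restoring_prob.simps)
  qed
  moreover have "bob_map I 0 2 (proj v) = proj v'"
  proof -
    have "0 < outcomes I" "out_dim I 0 = 2" "kraus I 0 = [K]"
      by (simp_all add: I_def real_instrument_def K_def)
    then show ?thesis
      using c bob_map_ensemble[OF I, of 0 "[v]" 2] v
      by (simp add: after_bob_def ensemble_single[of _ 8] ensemble_single[of _ 4] v'_def)
  qed
  moreover have "restoring_prob Stop 2 2 (proj v') = 2 * w"
  proof (rule restoring_prob_bell[OF c w])
    have a: "amp 2 v' a b = (\<Sum>c<4. K $$ (b, c) * amp 4 v a c)" if "a < 2" "b < 2" for a b
      using amp_bob[of K 4 v 2 a b] that v K by (simp add: v'_def act_def)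
    have r: "(\<Sum>c<4. complex_of_real (V x c) * complex_of_real (sqrt w * V y c))
      = complex_of_real (sqrt w * (\<Sum>c<4. V x c * V y c))" for x y
      by (simp add: sum_distrib_left mult_ac)
    have s: "(\<Sum>b<4. V j b * V i b) = 0" using rows(3) by (simp add: mult.commute)
    have "amp 2 v' 0 0 = complex_of_real (sqrt w)" "amp 2 v' 0 1 = 0"
      "amp 2 v' 1 0 = 0" "amp 2 v' 1 1 = complex_of_real (sqrt w)"
      using a[of 0 0] a[of 0 1] a[of 1 0] a[of 1 1] r[of i i] r[of i j] r[of j i] r[of j j] rows s
      by (simp_all add: K_def real_rows_def amp amp(2)[unfolded One_nat_def])
    then have "v' $ 0 = complex_of_real (sqrt w)" "v' $ 1 = 0" "v' $ 2 = 0" "v' $ 3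
        = complex_of_real (sqrt w)"
      by (simp_all add: amp_def)
    moreover fix k :: nat assume "k < 4"
    then have "k = 0 \<or> k = 1 \<or> k = 2 \<or> k = 3" by auto
    ultimately show "v' $ k = (if k \<in> {0, 3} then complex_of_real (sqrt w) else 0)" by auto
  qed
  moreover have "out_dim I 0 = 2" by (simp add: I_def real_instrument_def)
  ultimately show "2 * w \<le> restoring_prob P 2 4 (proj v)" by simp
qed

lemma schmidt_contract:
  fixes X V :: "nat \<Rightarrow> nat \<Rightarrow> real" and s :: "nat \<Rightarrow> real"
  assumes "\<And>j. j < n \<Longrightarrow> (\<Sum>a<d. X i a * X j a) = (if i = j then 1 else 0)" "i < n"
  shows "(\<Sum>a<d. X i a * (\<Sum>k<n. s k * X k a * V k b)) = s i * V i b"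
proof -
  have "(\<Sum>a<d. X i a * (\<Sum>k<n. s k * X k a * V k b)) = (\<Sum>a<d. \<Sum>k<n. s k * V k b * (X i a * X k a))"
    by (simp add: sum_distrib_left mult_ac)
  also have "\<dots> = (\<Sum>k<n. s k * V k b * (\<Sum>a<d. X i a * X k a))"
    by (subst sum.swap) (simp add: sum_distrib_left)
  also have "\<dots> = (\<Sum>k<n. if i = k then s k * V k b else 0)"
    using assms by (intro sum.cong) auto
  finally show ?thesis using assms(2) by simp
qed

text \<open>Alice's measurement splits the squared Schmidt coefficients \<open>p\<close> into weighted pairs
  \<open>w\<^sub>i\<^sub>j\<close> with \<open>\<Sum>\<^sub>j w\<^sub>i\<^sub>j \<le> p\<^sub>i\<close>, here
  \<open>w\<^sub>0\<^sub>1 = p\<^sub>1 - x\<close>, \<open>w\<^sub>0\<^sub>2 = p\<^sub>2 - x\<close>, \<open>w\<^sub>0\<^sub>3 = p\<^sub>3\<close>,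
  \<open>w\<^sub>1\<^sub>2 = x\<close> with \<open>x = max 0 (1 / 2 - p\<^sub>0)\<close>.
  Outcome \<open>{i, j}\<close> leaves two equal Schmidt coefficients, that is, a Bell pair up to local
  isometries, with probability \<open>2 w\<^sub>i\<^sub>j\<close>. Only the excess \<open>r = max 0 (2 p\<^sub>0 - 1)\<close> of index
  \<open>0\<close> fails. The vectors \<open>ys\<close> complete the Schmidt basis of Alice; they have probability \<open>0\<close>.\<close>

lemma schmidt_protocol:
  fixes X V :: "nat \<Rightarrow> nat \<Rightarrow> real" and p :: "nat \<Rightarrow> real" and ys :: "(nat \<Rightarrow> real) list"
  assumes v: "v \<in> carrier_vec (dA * 4)"
    and amp: "\<And>a b. a < dA \<Longrightarrow> b < 4 \<Longrightarrow>
      amp 4 v a b = complex_of_real (\<Sum>i<4. sqrt (p i) * X i a * V i b)"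
    and X: "\<And>i j. i < 4 \<Longrightarrow> j < 4 \<Longrightarrow> (\<Sum>a<dA. X i a * X j a) = (if i = j then 1 else 0)"
    and X_ys: "\<And>a b. a < dA \<Longrightarrow> b < dA \<Longrightarrow>
      (\<Sum>i<4. X i a * X i b) + (\<Sum>y\<leftarrow>ys. y a * y b) = (if a = b then 1 else 0)"
    and V: "\<And>i j. i < 4 \<Longrightarrow> j < 4 \<Longrightarrow> (\<Sum>b<4. V i b * V j b) = (if i = j then 1 else 0)"
    and V': "\<And>b c. b < 4 \<Longrightarrow> c < 4 \<Longrightarrow> (\<Sum>i<4. V i b * V i c) = (if b = c then 1 else 0)"
    and p: "\<And>i. i < 4 \<Longrightarrow> 0 < p i" "(\<Sum>i<4. p i) = 1" "1 / 2 \<le> p 0 + p 1" "1 / 2 \<le> p 0 + p 2"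
  shows "\<exists>P. is_protocol P dA 4 \<and> min 1 (2 * (1 - p 0)) \<le> restoring_prob P dA 4 (proj v)"
proof -
  \<comment> \<open>If \<open>p 0\<close> is at least 1/2, the other indices are all paired with 0
    and \<open>x = 0\<close>. Otherwise 0 must be used up exactly:
    \<open>p 1 + p 2 + p 3 - 2 * x = p 0\<close> forces \<open>x = 1 / 2 - p 0\<close>. The last two
    hypotheses on \<open>p\<close> say that this \<open>x\<close> exceeds neither \<open>p 1\<close>
    nor \<open>p 2\<close>.\<close>
  define x where "x = max 0 (1 / 2 - p 0)"
  define r where "r = max 0 (2 * p 0 - 1)"
  have psum: "p 0 + p 1 + p 2 + p 3 = 1" using p(2) by (simp add: sum_lessThan_4)
  have pos: "0 < p 0" "0 < p 1" "0 < p 2" "0 < p 3" using p(1) by auto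
  have w: "0 \<le> p 1 - x" "0 \<le> p 2 - x" "0 \<le> x" "0 \<le> r"
    using p(3,4) pos by (auto simp: x_def r_def)
  have r: "r = p 0 - (p 1 - x) - (p 2 - x) - p 3"
    using psum by (auto simp: x_def r_def max_def)
  \<comment> \<open>The factor turns the coefficient \<open>sqrt (p i)\<close> into
    \<open>sqrt w\<close> for every \<open>i\<close>, which is what equalises the two members of a
    pair.\<close>
  define R where "R = (\<lambda>w i c. sqrt (w / p i) * X i c)"
  \<comment> \<open>Four pairing outcomes with a qubit as output, then one failure outcome that
    collects the excess of index 0 and the padding rows, each as an operator with a single
    row.\<close>
  define L where "L = [[[R (p 1 - x) 0, R (p 1 - x) 1]], [[R (p 2 - x) 0, R (p 2 - x) 2]],
    [[R (p 3) 0, R (p 3) 3]], [[R x 1, R x 2]], [R r 0] # map (\<lambda>y. [y]) ys]"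
  define I where "I = real_instrument dA L"
  have RR: "R u i c * R u i e = u / p i * (X i c * X i e)" if "0 \<le> u" "0 < p i" for u i c e
    using that by (simp add: R_def power2_eq_square[symmetric] algebra_simps)
  have I: "is_instrument dA I"
    unfolding I_def
  proof (rule is_instrument_real)
    fix c e assume ce: "c < dA" "e < dA"
    have "concat (concat L) = [R (p 1 - x) 0, R (p 1 - x) 1, R (p 2 - x) 0, R (p 2 - x) 2,
        R (p 3) 0, R (p 3) 3, R x 1, R x 2, R r 0] @ ys"
      by (simp add: L_def concat_map_singleton[of id, simplified])
    then have "(\<Sum>q\<leftarrow>concat (concat L). q c * q e)
      = ((p 1 - x) / p 0 + (p 2 - x) / p 0 + p 3 / p 0 + r / p 0) * (X 0 c * X 0 e)
      + ((p 1 - x) / p 1 + x / p 1) * (X 1 c * X 1 e) + ((p 2 - x) / p 2 + x / p 2) * (X 2 c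
          * X 2 e)
      + p 3 / p 3 * (X 3 c * X 3 e) + (\<Sum>y\<leftarrow>ys. y c * y e)"
      using w pos by (simp add: RR) (simp only: distrib_right times_divide_eq_left add_ac)
    also have "(p 1 - x) / p 0 + (p 2 - x) / p 0 + p 3 / p 0 + r / p 0 = 1"
      using pos by (simp add: r flip: add_divide_distrib)
    also have "(p 1 - x) / p 1 + x / p 1 = 1" using pos by (simp flip: add_divide_distrib)
    also have "(p 2 - x) / p 2 + x / p 2 = 1" using pos by (simp flip: add_divide_distrib)
    also have "p 3 / p 3 = 1" using pos by simp
    finally show "(\<Sum>q\<leftarrow>concat (concat L). q c * q e) = (if c = e then 1 else 0)"
      using X_ys[OF ce] by (simp add: sum_lessThan_4)
  qed (auto simp: L_def)
  define B where "B = (\<lambda>i j k l. Bob_Op (real_instrument 4 [[[V i, V j]], [[V k], [V l]]]) (\<lambda>_.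
      Stop))"
  define Q where "Q = (\<lambda>i :: nat. if i = 0 then B 0 1 2 3 else if i = 1 then B 0 2 1 3
    else if i = 2 then B 0 3 1 2 else if i = 3 then B 1 2 0 3 else Stop)"
  \<comment> \<open>The condition \<open>kl\<close>, imposed for all \<open>f\<close>, says that
    \<open>i\<close>, \<open>j\<close>, \<open>k\<close>, \<open>l\<close> enumerate the four
    indices.\<close>
  have pair: "is_protocol (B i j k l) 2 4 \<and> 2 * u
      \<le> restoring_prob (B i j k l) 2 4 (proj (kron (real_rows dA [R u i, R u j]) (1\<^sub>m 4) *\<^sub>v v))"
    if u: "0 \<le> u" and ij: "i < 4" "j < 4" "i \<noteq> j"
      and kl: "\<And>f :: nat \<Rightarrow> real. f i + f j + f k + f l = (\<Sum>m<4. f m)" for u i j k l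
  proof -
    let ?K = "real_rows dA [R u i, R u j]"
    let ?v = "kron ?K (1\<^sub>m 4) *\<^sub>v v"
    have contract: "(\<Sum>c<dA. complex_of_real (R u i c) * amp 4 v c b)
        = complex_of_real (sqrt u * V i b)"
      if "b < 4" "i < 4" for b i
    proof -
      have "(\<Sum>c<dA. complex_of_real (R u i c) * amp 4 v c b)
        = complex_of_real (sqrt (u / p i) * (\<Sum>c<dA. X i c * (\<Sum>k<4. sqrt (p k) * X k c * V k b)))"
        using that by (simp add: R_def amp sum_distrib_left mult_ac)
      also have "\<dots> = complex_of_real (sqrt (u / p i) * (sqrt (p i) * V i b))"
        using X that by (subst schmidt_contract) auto
      also have "sqrt (u / p i) * (sqrt (p i) * V i b) = sqrt u * V i b"
        using p(1)[OF that(2)] by (simp add: real_sqrt_divide)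
      finally show ?thesis .
    qed
    have K: "?K \<in> carrier_mat 2 dA"
      by (intro carrier_matI) simp_all
    have c: "?v \<in> carrier_vec (2 * 4)"
      using mult_mat_vec_carrier[OF kron_carrier[OF K one_carrier_mat] v] .
    have a: "amp 4 ?v 0 b = complex_of_real (sqrt u * V i b)"
      "amp 4 ?v 1 b = complex_of_real (sqrt u * V j b)" if "b < 4" for b
      using amp_alice[of ?K dA v 4 0 b] amp_alice[of ?K dA v 4 1 b] v that ij contract
      by (simp_all add: act_def real_rows_def)
    have cols: "V i b * V i c + V j b * V j c + V k b * V k c + V l b * V l c = (if b
        = c then 1 else 0)"
      if "b < 4" "c < 4" for b c
      using kl[of "\<lambda>m. V m b * V m c"] V'[OF that] by simp
    have rows: "(\<Sum>b<4. V i b * V i b) = 1" "(\<Sum>b<4. V j b * V j b) = 1" "(\<Sum>b<4. V i b * V j b) = 0"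
      using V ij by simp_all
    note bell = bob_completes_bell[where v = ?v and w = u and V = V and i = i and j = j and k
        = k and l = l,
      OF c u a rows cols B_def[THEN fun_cong, THEN fun_cong, THEN fun_cong, THEN fun_cong]]
    show ?thesis by (intro conjI bell)
  qed
  have perm: "\<And>f :: nat \<Rightarrow> real. f 0 + f 1 + f 2 + f 3 = (\<Sum>m<4. f m)"
    "\<And>f :: nat \<Rightarrow> real. f 0 + f 2 + f 1 + f 3 = (\<Sum>m<4. f m)"
    "\<And>f :: nat \<Rightarrow> real. f 0 + f 3 + f 1 + f 2 = (\<Sum>m<4. f m)"
    "\<And>f :: nat \<Rightarrow> real. f 1 + f 2 + f 0 + f 3 = (\<Sum>m<4. f m)"
    by (simp_all add: sum_lessThan_4)
  have b01: "is_protocol (Q 0) 2 4" "2 * (p 1 - x) \<le> restoring_prob (Q 0) 2 4 (proj (kron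
      (real_rows dA [R (p 1 - x) 0, R (p 1 - x) 1]) (1\<^sub>m 4) *\<^sub>v v))"
    using pair[of "p 1 - x" 0 1 2 3] w perm(1) by (auto simp: Q_def)
  have b02: "is_protocol (Q 1) 2 4" "2 * (p 2 - x) \<le> restoring_prob (Q 1) 2 4 (proj (kron
      (real_rows dA [R (p 2 - x) 0, R (p 2 - x) 2]) (1\<^sub>m 4) *\<^sub>v v))"
    using pair[of "p 2 - x" 0 2 1 3] w perm(2) by (auto simp: Q_def)
  have b03: "is_protocol (Q 2) 2 4" "2 * p 3 \<le> restoring_prob (Q 2) 2 4 (proj (kron (real_rows dA
      [R (p 3) 0, R (p 3) 3]) (1\<^sub>m 4) *\<^sub>v v))"
    using pair[of "p 3" 0 3 1 2] pos perm(3) by (auto simp: Q_def)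
  have b12: "is_protocol (Q 3) 2 4" "2 * x \<le> restoring_prob (Q 3) 2 4 (proj (kron (real_rows dA [R
      x 1, R x 2]) (1\<^sub>m 4) *\<^sub>v v))"
    using pair[of x 1 2 0 3] w perm(4) by (auto simp: Q_def)
  have out: "outcomes I = 5" "out_dim I 0 = 2" "out_dim I 1 = 2" "out_dim I 2 = 2" "out_dim I 3
      = 2" "out_dim I 4 = 1"
    by (simp_all add: I_def L_def real_instrument_def)
  have kraus: "kraus I 0 = [real_rows dA [R (p 1 - x) 0, R (p 1 - x) 1]]"
    "kraus I 1 = [real_rows dA [R (p 2 - x) 0, R (p 2 - x) 2]]"
    "kraus I 2 = [real_rows dA [R (p 3) 0, R (p 3) 3]]"
    "kraus I 3 = [real_rows dA [R x 1, R x 2]]"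
    by (simp_all add: I_def L_def real_instrument_def)
  have five: "i = 0 \<or> i = 1 \<or> i = 2 \<or> i = 3 \<or> i = 4" if "i < 5" for i :: nat
    using that by auto
  have "is_protocol (Alice_Op I Q) dA 4"
  proof -
    have "Q 4 = Stop" by (simp add: Q_def)
    then have "is_protocol (Q i) (out_dim I i) 4" if "i < 5" for i
      using five[OF that] b01(1) b02(1) b03(1) b12(1) out by auto
    then show ?thesis using I out(1) by simp
  qed
  moreover have "min 1 (2 * (1 - p 0)) \<le> restoring_prob (Alice_Op I Q) dA 4 (proj v)"
  proof -
    have step: "alice_map I i 4 (proj v) = proj (kron K (1\<^sub>m 4) *\<^sub>v v)"
      if "i < 5" "out_dim I i = 2" "kraus I i = [K]" for i K
    proof -
      have "kron K (1\<^sub>m 4) *\<^sub>v v \<in> carrier_vec (2 * 4)"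
        using that after_alice_carrier[OF I, of i "[v]" 4] v by (simp add: out after_alice_def)
      then show ?thesis
        using alice_map_ensemble[OF I, of i "[v]" 4] v that
        by (simp add: ensemble_single[of _ "dA * 4"] ensemble_single[of _ 8] after_alice_def out)
    qed
    have "0 \<le> restoring_prob (Q 4) (out_dim I 4) 4 (alice_map I 4 4 (proj v))"
      using alice_map_ensemble[OF I, of 4 "[v]" 4] after_alice_carrier[OF I, of 4 "[v]" 4] v
        restoring_prob_nonneg[of Stop "out_dim I 4" 4 "after_alice 4 (kraus I 4) [v]"]
      by (simp add: ensemble_single[of _ "dA * 4"] Q_def out del: restoring_prob.simps)
    moreover have "restoring_prob (Alice_Op I Q) dA 4 (proj v)
      = (\<Sum>i\<in>{0, 1, 2, 3, 4}. restoring_prob (Q i) (out_dim I i) 4 (alice_map I i 4 (proj v)))"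
      unfolding restoring_prob.simps by (intro sum.cong) (auto simp: out)
    \<comment> \<open>The total is \<open>2 * (1 - p 0) - 2 * x\<close>: for \<open>x = 0\<close> it
      is the second entry of the minimum, for \<open>x = 1 / 2 - p 0\<close> it is 1.\<close>
    moreover have "min 1 (2 * (1 - p 0)) = 2 * (p 1 - x) + 2 * (p 2 - x) + 2 * p 3 + 2 * x"
      using psum by (auto simp: x_def min_def max_def)
    ultimately show ?thesis
      using b01(2) b02(2) b03(2) b12(2)
        step[OF _ out(2) kraus(1)] step[OF _ out(3) kraus(2)] step[OF _ out(4) kraus(3)] step[OF _
            out(5) kraus(4)]
      by (simp add: out[simplified])
  qed
  ultimately show ?thesis by blast
qed

text \<open>The protocol above meets the potential of the initial vector. For the upper bound the
  vectors \<open>X 0\<close> and \<open>V 0\<close> suffice as test vectors, since only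
  \<open>p 0 \<le> top_schmidt\<close> is required.\<close>

lemma schmidt_maximum:
  fixes X V :: "nat \<Rightarrow> nat \<Rightarrow> real" and p :: "nat \<Rightarrow> real" and ys :: "(nat \<Rightarrow> real) list"
  assumes v: "v \<in> carrier_vec (dA * 4)"
    and amp: "\<And>a b. a < dA \<Longrightarrow> b < 4 \<Longrightarrow>
      amp 4 v a b = complex_of_real (\<Sum>i<4. sqrt (p i) * X i a * V i b)"
    and X: "\<And>i j. i < 4 \<Longrightarrow> j < 4 \<Longrightarrow> (\<Sum>a<dA. X i a * X j a) = (if i = j then 1 else 0)"
    and X_ys: "\<And>a b. a < dA \<Longrightarrow> b < dA \<Longrightarrow>
      (\<Sum>i<4. X i a * X i b) + (\<Sum>y\<leftarrow>ys. y a * y b) = (if a = b then 1 else 0)"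
    and V: "\<And>i j. i < 4 \<Longrightarrow> j < 4 \<Longrightarrow> (\<Sum>b<4. V i b * V j b) = (if i = j then 1 else 0)"
    and V': "\<And>b c. b < 4 \<Longrightarrow> c < 4 \<Longrightarrow> (\<Sum>i<4. V i b * V i c) = (if b = c then 1 else 0)"
    and p: "\<And>i. i < 4 \<Longrightarrow> 0 < p i" "(\<Sum>i<4. p i) = 1" "1 / 2 \<le> p 0 + p 1" "1 / 2 \<le> p 0 + p 2"
  shows "is_maximum (achievable_probs dA 4 (proj v)) (min 1 (2 * (1 - p 0)))"
proof -
  have "potential dA 4 (amp 4 v) \<le> min 1 (2 * (1 - p 0))"
  proof -
    let ?M = "\<lambda>a b. \<Sum>i<4. sqrt (p i) * X i a * V i b"
    have V0: "(\<Sum>b<4. ?M a b * V i b) = sqrt (p i) * X i a" if "i < 4" for a i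
    proof -
      have "(\<Sum>b<4. ?M a b * V i b) = (\<Sum>b<4. V i b * (\<Sum>k<4. sqrt (p k) * V k b * X k a))"
        by (simp add: mult_ac)
      also have "\<dots> = sqrt (p i) * X i a"
        using V that by (intro schmidt_contract) auto
      finally show ?thesis .
    qed
    have sq: "(?M a b)\<^sup>2 = (\<Sum>i<4. sqrt (p i) * X i a * (?M a b * V i b))" for a b
    proof -
      have "(?M a b)\<^sup>2 = (\<Sum>i<4. sqrt (p i) * X i a * V i b) * ?M a b"
        by (simp only: power2_eq_square)
      also have "\<dots> = (\<Sum>i<4. sqrt (p i) * X i a * (?M a b * V i b))"
        by (subst sum_distrib_right) (intro sum.cong refl, simp only: mult_ac)
      finally show ?thesis .
    qed
    have square: "sqrt (p i) * X i a * (sqrt (p i) * X i a) = p i * (X i a)\<^sup>2" if "i < 4" for a i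
    proof -
      have "sqrt (p i) * sqrt (p i) = p i" using p(1)[OF that] by simp
      then have "(sqrt (p i) * sqrt (p i)) * (X i a * X i a) = p i * (X i a)\<^sup>2"
        by (simp only: power2_eq_square)
      then show ?thesis by (simp only: mult_ac)
    qed
    \<comment> \<open>Parseval's identity for row \<open>a\<close> of the amplitude matrix in the
      orthonormal basis \<open>V\<close> of Bob.\<close>
    have row: "(\<Sum>b<4. (?M a b)\<^sup>2) = (\<Sum>i<4. p i * (X i a)\<^sup>2)" for a
    proof -
      have "(\<Sum>b<4. (?M a b)\<^sup>2) = (\<Sum>b<4. \<Sum>i<4. sqrt (p i) * X i a * (?M a b * V i b))"
        by (intro sum.cong refl sq)
      also have "\<dots> = (\<Sum>i<4. sqrt (p i) * X i a * (\<Sum>b<4. ?M a b * V i b))"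
        by (subst sum.swap) (simp only: sum_distrib_left)
      also have "\<dots> = (\<Sum>i<4. p i * (X i a)\<^sup>2)"
        by (intro sum.cong refl) (simp only: lessThan_iff V0 square)
      finally show ?thesis .
    qed
    have "sqnorm dA 4 (amp 4 v) = (\<Sum>a<dA. \<Sum>b<4. (?M a b)\<^sup>2)"
      unfolding sqnorm_def by (intro sum.cong refl) (simp add: amp del: of_real_sum)
    also have "\<dots> = (\<Sum>i<4. p i * (\<Sum>a<dA. X i a * X i a))"
      unfolding row by (subst sum.swap) (simp add: sum_distrib_left power2_eq_square)
    also have "\<dots> = 1" using X p(2) by simp
    finally have n: "sqnorm dA 4 (amp 4 v) = 1" .
    let ?u = "\<lambda>a. complex_of_real (X 0 a)" and ?w = "\<lambda>b. complex_of_real (V 0 b)"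
    have "(\<Sum>a<dA. ?u a * (\<Sum>b<4. amp 4 v a b * ?w b))
      = complex_of_real (\<Sum>a<dA. X 0 a * (\<Sum>b<4. ?M a b * V 0 b))"
      by (simp add: amp)
    also have "\<dots> = complex_of_real (sqrt (p 0) * (\<Sum>a<dA. X 0 a * X 0 a))"
      unfolding V0[OF zero_less_numeral] by (simp only: sum_distrib_left mult_ac)
    finally have "overlap dA 4 (amp 4 v) ?u ?w = p 0"
      using X[of 0 0] p(1)[of 0] by (simp add: overlap_def norm_mult)
    moreover have "subunit dA ?u" "subunit 4 ?w"
      using X[of 0 0] V[of 0 0] by (simp_all add: subunit_def power2_eq_square)
    ultimately have "p 0 \<le> top_schmidt dA 4 (amp 4 v)"
      by (metis overlap_le_top_schmidt)
    with n show ?thesis by (simp add: potential_def)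
  qed
  then have le: "q \<le> min 1 (2 * (1 - p 0))" if "q \<in> achievable_probs dA 4 (proj v)" for q
    using that restoring_prob_le_potential[of _ dA 4 "[v]"] v
    by (fastforce simp: achievable_probs_def ensemble_single[of _ "dA * 4"])
  obtain P where P: "is_protocol P dA 4" "min 1 (2 * (1 - p 0)) \<le> restoring_prob P dA 4 (proj v)"
    using schmidt_protocol[OF v amp X X_ys V V' p] by blast
  then have mem: "restoring_prob P dA 4 (proj v) \<in> achievable_probs dA 4 (proj v)"
    by (auto simp: achievable_probs_def)
  with le[OF mem] P(2) have "restoring_prob P dA 4 (proj v) = min 1 (2 * (1 - p 0))" by linarith
  with mem le show ?thesis by (simp add: is_maximum_def)
qed

section \<open>The two models\<close>

lemma sum_block_mult:
  fixes f g :: "nat \<Rightarrow> real"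
  assumes "A < 2" "B < 2"
  shows "(\<Sum>x<2 * d. (if x div d = A then f (x mod d) else 0) * (if x div d
      = B then g (x mod d) else 0))
    = (if A = B then \<Sum>c<d. f c * g c else 0)"
proof -
  have "(\<Sum>x<2 * d. (if x div d = A then f (x mod d) else 0) * (if x div d
      = B then g (x mod d) else 0))
    = (\<Sum>a<2. \<Sum>c<d. (if a = A then f c else 0) * (if a = B then g c else 0))"
    unfolding sum_mult_block by (intro sum.cong refl) auto
  also have "\<dots> = (if A = B then \<Sum>c<d. f c * g c else 0)"
    using assms by (auto simp: sum_lessThan_2 less_2_cases_iff)
  finally show ?thesis .
qed

text \<open>Schmidt decompositions multiply: index \<open>2 * A + k\<close> carries weight
  \<open>q A * \<mu> k\<close> and the vectors |A> times \<open>a k\<close> and |A> times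
  \<open>b k\<close>. The list \<open>zs\<close> completes the \<open>a k\<close> to a basis of the
  d-dimensional factor, and one copy of it is needed for each value of A.\<close>

lemma product_state_maximum:
  fixes a b :: "nat \<Rightarrow> nat \<Rightarrow> real" and zs :: "(nat \<Rightarrow> real) list" and q \<mu> :: "nat \<Rightarrow> real"
  assumes v: "v \<in> carrier_vec (2 * d * 4)"
    and amp: "\<And>A A' B B'. A < 2 \<Longrightarrow> A' < d \<Longrightarrow> B < 2 \<Longrightarrow> B' < 2 \<Longrightarrow>
      amp 4 v (A * d + A') (B * 2 + B')
        = complex_of_real ((if A = B then sqrt (q A) else 0) * (\<Sum>k<2. sqrt (\<mu> k) * a k A'
            * b k B'))"
    and a: "\<And>k l. k < 2 \<Longrightarrow> l < 2 \<Longrightarrow> (\<Sum>c<d. a k c * a l c) = (if k = l then 1 else 0)"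
    and a_zs: "\<And>c e. c < d \<Longrightarrow> e < d \<Longrightarrow>
      (\<Sum>k<2. a k c * a k e) + (\<Sum>z\<leftarrow>zs. z c * z e) = (if c = e then 1 else 0)"
    and b: "\<And>k l. k < 2 \<Longrightarrow> l < 2 \<Longrightarrow> (\<Sum>c<2. b k c * b l c) = (if k = l then 1 else 0)"
    and b': "\<And>c e. c < 2 \<Longrightarrow> e < 2 \<Longrightarrow> (\<Sum>k<2. b k c * b k e) = (if c = e then 1 else 0)"
    and q: "0 < q 0" "0 < q 1" "q 0 + q 1 = 1" "1 / 2 \<le> q 0"
    and \<mu>: "0 < \<mu> 0" "0 < \<mu> 1" "\<mu> 0 + \<mu> 1 = 1" "1 / 2 \<le> \<mu> 0"
  shows "is_maximum (achievable_probs (2 * d) 4 (proj v)) (min 1 (2 * (1 - q 0 * \<mu> 0)))"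
proof -
  define X where "X = (\<lambda>i x. if x div d = i div 2 then a (i mod 2) (x mod d) else 0)"
  define V where "V = (\<lambda>i x. if x div 2 = i div 2 then b (i mod 2) (x mod 2) else 0)"
  define p where "p = (\<lambda>i :: nat. q (i div 2) * \<mu> (i mod 2))"
  define E where "E = (\<lambda>A z x. if x div d = A then z (x mod d) else 0 :: real)"
  have p_simps: "p 0 = q 0 * \<mu> 0" "p (Suc 0) = q 0 * \<mu> 1" "p 2 = q 1 * \<mu> 0" "p 3 = q 1 * \<mu> 1"
    by (simp_all add: p_def)
  have four: "(\<Sum>i<4. f i) = (\<Sum>A<2. \<Sum>k<2. f (A * 2 + k))" for f :: "nat \<Rightarrow> real"
    using sum_mult_block[of f 2 2] by simp
  have two: "i < 2 \<longleftrightarrow> i = 0 \<or> i = 1" for i :: nat by auto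
  have halves: "i div 2 < 2" "i mod 2 < 2" "i div 2 * 2 + i mod 2 = i" if "i < 4" for i :: nat
    using that by auto
  have eq_halves: "i = j \<longleftrightarrow> i div 2 = j div 2 \<and> i mod 2 = j mod 2" for i j :: nat
    by (metis div_mult_mod_eq)
  have "is_maximum (achievable_probs (2 * d) 4 (proj v)) (min 1 (2 * (1 - p 0)))"
  proof (rule schmidt_maximum[where X = X and V = V and ys = "map (E 0) zs @ map (E 1) zs"])
    fix x y assume x: "x < 2 * d" and y: "y < (4 :: nat)"
    have d: "0 < d" using x by (cases d) auto
    have xd: "x div d < 2" "x mod d < d" "x div d * d + x mod d = x"
      using x d by (auto simp: less_mult_imp_div_less)
    have "amp 4 v x y = complex_of_real ((if x div d = y div 2 then sqrt (q (x div d)) else 0)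
        * (\<Sum>k<2. sqrt (\<mu> k) * a k (x mod d) * b k (y mod 2)))"
      using amp[OF xd(1,2) halves(1,2)[OF y]] xd(3) halves(3)[OF y] by simp
    also have "(if x div d = y div 2 then sqrt (q (x div d)) else 0)
        * (\<Sum>k<2. sqrt (\<mu> k) * a k (x mod d) * b k (y mod 2)) = (\<Sum>i<4. sqrt (p i) * X i x * V i y)"
      using xd(1) halves(1)[OF y] unfolding four two
      by (auto simp: p_def X_def V_def sum_lessThan_2 real_sqrt_mult algebra_simps)
    finally show "amp 4 v x y = complex_of_real (\<Sum>i<4. sqrt (p i) * X i x * V i y)" .
  next
    fix i j :: nat assume ij: "i < 4" "j < 4"
    show "(\<Sum>x<2 * d. X i x * X j x) = (if i = j then 1 else 0)"
      unfolding X_def sum_block_mult[OF halves(1)[OF ij(1)] halves(1)[OF ij(2)]]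
      using a[OF halves(2)[OF ij(1)] halves(2)[OF ij(2)]] eq_halves[of i j] by auto
    have "(\<Sum>x<4. V i x * V j x) = (\<Sum>x<2 * 2. V i x * V j x)" by simp
    also have "\<dots> = (if i = j then 1 else 0)"
      unfolding V_def sum_block_mult[OF halves(1)[OF ij(1)] halves(1)[OF ij(2)]]
      using b[OF halves(2)[OF ij(1)] halves(2)[OF ij(2)]] eq_halves[of i j] by auto
    finally show "(\<Sum>x<4. V i x * V j x) = (if i = j then 1 else 0)" .
  next
    fix x y assume xy: "x < 2 * d" "y < 2 * d"
    have d: "0 < d" using xy by (cases d) auto
    have xyd: "x div d < 2" "y div d < 2" using xy by (auto simp: less_mult_imp_div_less)
    have eq: "x = y \<longleftrightarrow> x div d = y div d \<and> x mod d = y mod d" by (metis div_mult_mod_eq)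
    have "(\<Sum>z\<leftarrow>map (E A) zs. z x * z y)
      = (if x div d = A \<and> y div d = A then \<Sum>z\<leftarrow>zs. z (x mod d) * z (y mod d) else 0)" for A
      by (auto simp: E_def o_def)
    moreover have "(\<Sum>i<4. X i x * X i y)
      = (if x div d = y div d then \<Sum>k<2. a k (x mod d) * a k (y mod d) else 0)"
      using xyd unfolding four two by (auto simp: X_def sum_lessThan_2)
    ultimately show "(\<Sum>i<4. X i x * X i y) + (\<Sum>z\<leftarrow>map (E 0) zs @ map (E 1) zs. z x * z y)
        = (if x = y then 1 else 0)"
      using a_zs[of "x mod d" "y mod d"] d xyd eq unfolding two by auto
  next
    fix x y :: nat assume xy: "x < 4" "y < 4"
    have "(\<Sum>i<4. V i x * V i y)
      = (if x div 2 = y div 2 then \<Sum>k<2. b k (x mod 2) * b k (y mod 2) else 0)"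
      using halves(1)[OF xy(1)] halves(1)[OF xy(2)] unfolding four two
      by (auto simp: V_def sum_lessThan_2)
    also have "\<dots> = (if x = y then 1 else 0)"
      unfolding b'[OF halves(2)[OF xy(1)] halves(2)[OF xy(2)]] eq_halves[of x y] by simp
    finally show "(\<Sum>i<4. V i x * V i y) = (if x = y then 1 else 0)" .
  next
    fix i :: nat assume "i < 4"
    then have "i = 0 \<or> i = Suc 0 \<or> i = 2 \<or> i = 3" by auto
    then show "0 < p i" using q \<mu> by (auto simp: p_simps)
  next
    have "(\<Sum>i<4. p i) = (q 0 + q 1) * (\<mu> 0 + \<mu> 1)"
      unfolding four by (simp add: p_def sum_lessThan_2 algebra_simps)
    then show "(\<Sum>i<4. p i) = 1" using q \<mu> by simp
    have "p 0 + p 1 = q 0 * (\<mu> 0 + \<mu> 1)" "p 0 + p 2 = (q 0 + q 1) * \<mu> 0"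
      by (simp_all add: p_simps algebra_simps)
    then show "1 / 2 \<le> p 0 + p 1" "1 / 2 \<le> p 0 + p 2" using q \<mu> by simp_all
  qed (rule v)
  then show ?thesis by (simp add: p_simps)
qed

section \<open>Singular values of the conditional W state\<close>

lemma orthonormal_rows_imp_columns:
  fixes p q r s :: real
  assumes "p * p + q * q = 1" "r * r + s * s = 1" "p * r + q * s = 0"
  shows "p * p + r * r = 1" "q * q + s * s = 1" "p * q + r * s = 0"
proof -
  \<comment> \<open>The determinant. The second row is \<open>t\<close> times the first row turned
    by a right angle, and equality of the lengths gives \<open>t * t = 1\<close>.\<close>
  define t where "t = p * s - q * r"
  have qs: "q * s = - (p * r)" and pr: "p * r = - (q * s)" using assms(3) by linarith+
  have "- (q * t) = q * q * r - p * (q * s)" by (simp add: t_def algebra_simps)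
  also have "\<dots> = (p * p + q * q) * r" unfolding qs by (simp add: algebra_simps)
  finally have r: "r = - (q * t)" using assms(1) by simp
  have "p * t = p * p * s - q * (p * r)" by (simp add: t_def algebra_simps)
  also have "\<dots> = (p * p + q * q) * s" unfolding pr by (simp add: algebra_simps)
  finally have s: "s = p * t" using assms(1) by simp
  have "r * r + s * s = (p * p + q * q) * (t * t)" unfolding r s by (simp add: algebra_simps)
  then have t: "t * t = 1" using assms(1,2) by simp
  have "r * r = q * q * (t * t)" "s * s = p * p * (t * t)" "r * s = - (p * q * (t * t))"
    unfolding r s by (simp_all add: mult_ac)
  then show "p * p + r * r = 1" "q * q + s * s = 1" "p * q + r * s = 0"
    using assms(1) by (simp_all add: t)
qed

definition tab2 :: "real \<Rightarrow> real \<Rightarrow> real \<Rightarrow> real \<Rightarrow> nat \<Rightarrow> nat \<Rightarrow> real" where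
  "tab2 p q r s i j = (if i = 0 then if j = 0 then p else q else if j = 0 then r else s)"

text \<open>By the inequality of arithmetic and geometric means the left side is at most the square
  of \<open>1 - x\<^sup>2\<close>, which is below 1 because \<open>x\<close> is nonzero.\<close>

lemma discriminant_less_1:
  fixes x y z :: real
  assumes norm: "x\<^sup>2 + y\<^sup>2 + z\<^sup>2 = 1" and nz: "x \<noteq> 0"
  shows "4 * y\<^sup>2 * z\<^sup>2 < 1"
proof -
  have "4 * y\<^sup>2 * z\<^sup>2 \<le> (y\<^sup>2 + z\<^sup>2)\<^sup>2"
    using zero_le_power2[of "y\<^sup>2 - z\<^sup>2"] by (simp add: power2_eq_square algebra_simps)
  also have "y\<^sup>2 + z\<^sup>2 = 1 - x\<^sup>2" using norm by simp
  finally have le: "4 * y\<^sup>2 * z\<^sup>2 \<le> (1 - x\<^sup>2)\<^sup>2" .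
  have "x\<^sup>2 \<le> 1"
    using norm zero_le_power2[of y] zero_le_power2[of z] by linarith
  then have "(1 - x\<^sup>2)\<^sup>2 < 1\<^sup>2"
    using nz by (intro power_strict_mono) auto
  with le show ?thesis by simp
qed

text \<open>The right singular vectors are an orthonormal eigenbasis of the Gram matrix, and
  \<open>1 - 4 y\<^sup>2 z\<^sup>2\<close> is the discriminant of its characteristic polynomial.\<close>

lemma singular_value_decomposition:
  fixes x y z :: real
  assumes norm: "x\<^sup>2 + y\<^sup>2 + z\<^sup>2 = 1" and nz: "x \<noteq> 0" "y \<noteq> 0" "z \<noteq> 0"
    and \<mu>: "\<mu> = (\<lambda>k :: nat. if k = 0 then (1 + sqrt (1 - 4 * y\<^sup>2 * z\<^sup>2)) / 2 else (1 - sqrt (1 - 4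
        * y\<^sup>2 * z\<^sup>2)) / 2)"
  obtains a b :: "nat \<Rightarrow> nat \<Rightarrow> real" where
    "\<And>k l. k < 2 \<Longrightarrow> l < 2 \<Longrightarrow> (\<Sum>c<2. a k c * a l c) = (if k = l then 1 else 0)"
    "\<And>c e. c < 2 \<Longrightarrow> e < 2 \<Longrightarrow> (\<Sum>k<2. a k c * a k e) = (if c = e then 1 else 0)"
    "\<And>k l. k < 2 \<Longrightarrow> l < 2 \<Longrightarrow> (\<Sum>c<2. b k c * b l c) = (if k = l then 1 else 0)"
    "\<And>c e. c < 2 \<Longrightarrow> e < 2 \<Longrightarrow> (\<Sum>k<2. b k c * b k e) = (if c = e then 1 else 0)"
    "\<And>i j. i < 2 \<Longrightarrow> j < 2 \<Longrightarrow> tab2 x y z 0 i j = (\<Sum>k<2. sqrt (\<mu> k) * a k i * b k j)"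
    "0 < \<mu> 0" "0 < \<mu> 1" "\<mu> 0 + \<mu> 1 = 1" "1 / 2 \<le> \<mu> 0"
proof -
  have D: "4 * y\<^sup>2 * z\<^sup>2 < 1" by (rule discriminant_less_1[OF norm nz(1)])
  define m where "m = \<mu> 0"
  define n where "n = \<mu> 1"
  have sq: "(sqrt (1 - 4 * y\<^sup>2 * z\<^sup>2))\<^sup>2 = 1 - 4 * y\<^sup>2 * z\<^sup>2" using D by simp
  have "0 < y\<^sup>2 * z\<^sup>2" using nz by simp
  then have "sqrt (1 - 4 * y\<^sup>2 * z\<^sup>2) < sqrt 1" by (intro real_sqrt_less_mono) simp
  moreover define S where "S = sqrt (1 - 4 * y\<^sup>2 * z\<^sup>2)"
  ultimately have S: "S < 1" "0 < S" using D by simp_all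
  have "m = (1 + S) / 2" "n = (1 - S) / 2" by (simp_all add: m_def n_def \<mu> S_def)
  with S have mn: "0 < m" "0 < n" "m + n = 1" "1 / 2 \<le> m" by auto
  \<comment> \<open>The Gram matrix has rows \<open>(x\<^sup>2 + z\<^sup>2, x * y)\<close> and
    \<open>(x * y, y\<^sup>2)\<close>, hence trace 1 and determinant
    \<open>y\<^sup>2 * z\<^sup>2\<close>.\<close>
  have char: "m * m - m + y\<^sup>2 * z\<^sup>2 = 0"
    using sq by (simp add: m_def \<mu> power2_eq_square field_simps)
  \<comment> \<open>\<open>(m - y\<^sup>2, x * y)\<close> solves the second row of the eigenvalue
    equation for \<open>m\<close>, and it is nonzero because \<open>x * y\<close> is.\<close>
  define N where "N = sqrt ((m - y\<^sup>2)\<^sup>2 + (x * y)\<^sup>2)"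
  have N0: "0 < N" unfolding N_def using nz by (intro real_sqrt_gt_zero add_nonneg_pos) auto
  have N2: "N * N = (m - y\<^sup>2)\<^sup>2 + (x * y)\<^sup>2" unfolding N_def
      by (intro real_sqrt_mult_self[THEN trans]) auto
  define e where "e = (m - y\<^sup>2) / N"
  define f where "f = x * y / N"
  have "e * e + f * f = ((m - y\<^sup>2)\<^sup>2 + (x * y)\<^sup>2) / (N * N)"
    by (simp add: e_def f_def power2_eq_square add_divide_distrib)
  then have ef: "e * e + f * f = 1"
    unfolding N2[symmetric] using N0 by simp
  have x2: "x * x = 1 - y * y - z * z" using norm by (simp add: power2_eq_square)
  have char': "m * m = m - y * y * (z * z)" using char by (simp add: power2_eq_square)
  have "(x * x + z * z) * (m - y * y) + x * y * (x * y) = x * x * m + z * z * m - z * z * (y * y)"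
    by (simp add: algebra_simps)
  also have "\<dots> = m - y * y * m - y * y * (z * z)"
    unfolding x2 by (simp add: algebra_simps)
  also have "\<dots> = m * (m - y * y)"
    using char' by (simp add: algebra_simps)
  finally have eq: "(x * x + z * z) * (m - y * y) + x * y * (x * y) = m * (m - y * y)" .
  have "(x * x + z * z) * e + x * y * f = ((x * x + z * z) * (m - y * y) + x * y * (x * y)) / N"
    by (simp add: e_def f_def power2_eq_square add_divide_distrib)
  then have eig1: "(x * x + z * z) * e + x * y * f = m * e"
    unfolding eq by (simp add: e_def power2_eq_square)
  have "x * y * e + y * y * f = (x * y * (m - y * y) + y * y * (x * y)) / N"
    by (simp add: e_def f_def power2_eq_square add_divide_distrib)
  also have "x * y * (m - y * y) + y * y * (x * y) = m * (x * y)"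
    by (simp add: algebra_simps)
  finally have eig2: "x * y * e + y * y * f = m * f" by (simp add: f_def)
  note eig = eig1 eig2
  \<comment> \<open>The images of \<open>(e, f)\<close> and \<open>(- f, e)\<close> are
    \<open>(g, z * e)\<close> and \<open>(h, - (z * f))\<close>; divided by the singular values they
    become the left singular vectors.\<close>
  define g where "g = x * e + y * f"
  define h where "h = y * e - x * f"
  have G: "g * g + (z * e) * (z * e) = m"
  proof -
    have "g * g + (z * e) * (z * e) = e * ((x * x + z * z) * e + x * y * f) + f * (x * y * e + y
        * y * f)"
      by (simp add: g_def algebra_simps)
    also have "\<dots> = m * (e * e + f * f)"
      unfolding eig by (simp add: algebra_simps)
    finally show ?thesis by (simp add: ef)
  qed
  have H: "h * h + (z * f) * (z * f) = n"
  proof -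
    have "h * h + (z * f) * (z * f) = (x * x + y * y + z * z) * (e * e + f * f) - (g * g + (z * e)
        * (z * e))"
      by (simp add: g_def h_def algebra_simps)
    also have "\<dots> = 1 - m" unfolding ef G x2 by simp
    finally show ?thesis using mn(3) by simp
  qed
  have GH: "g * h + (z * e) * (- (z * f)) = 0"
  proof -
    have "g * h + (z * e) * (- (z * f)) = e * (x * y * e + y * y * f) - f * ((x * x + z * z) * e
        + x * y * f)"
      by (simp add: g_def h_def algebra_simps)
    also have "\<dots> = 0" unfolding eig by simp
    finally show ?thesis .
  qed
  define r where "r = sqrt m"
  define s where "s = sqrt n"
  have rs: "0 < r" "0 < s" "r * r = m" "s * s = n" using mn by (auto simp: r_def s_def)
  have a1: "(g / r) * (g / r) + (z * e / r) * (z * e / r) = 1"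
    using rs G mn by (simp flip: add_divide_distrib)
  have a2: "(h / s) * (h / s) + (- (z * f) / s) * (- (z * f) / s) = 1"
    using rs H mn by (simp flip: add_divide_distrib)
  have a3: "(g / r) * (h / s) + (z * e / r) * (- (z * f) / s) = 0"
    using rs GH by (simp flip: add_divide_distrib diff_divide_distrib)
  note a4 = orthonormal_rows_imp_columns[OF a1 a2 a3]
  define a where "a = tab2 (g / r) (z * e / r) (h / s) (- (z * f) / s)"
  define b where "b = tab2 e f (- f) e"
  have two: "i < 2 \<longleftrightarrow> i = 0 \<or> i = 1" for i :: nat by auto
  show thesis
  proof (rule that[of a b])
    show "(\<Sum>c<2. a k c * a l c) = (if k = l then 1 else 0)" if "k < 2" "l < 2" for k l
      using that a1 a2 a3 unfolding two by (auto simp: a_def tab2_def sum_lessThan_2 mult.commute)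
    show "(\<Sum>k<2. a k c * a k e) = (if c = e then 1 else 0)" if "c < 2" "e < 2" for c e
      using that a4 unfolding two by (auto simp: a_def tab2_def sum_lessThan_2 mult.commute)
    show "(\<Sum>c<2. b k c * b l c) = (if k = l then 1 else 0)" if "k < 2" "l < 2" for k l
      using that ef unfolding two by (auto simp: b_def tab2_def sum_lessThan_2 mult.commute
          add.commute)
    show "(\<Sum>k<2. b k c * b k e) = (if c = e then 1 else 0)" if "c < 2" "e < 2" for c e
      using that ef unfolding two by (auto simp: b_def tab2_def sum_lessThan_2 mult.commute
          add.commute)
    have "sqrt (\<mu> 0) = r" "sqrt (\<mu> (Suc 0)) = s" by (simp_all add: r_def s_def m_def n_def)
    \<comment> \<open>The matrix is recovered from its images of the orthonormal basis
      \<open>(e, f)\<close>, \<open>(- f, e)\<close>.\<close>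
    moreover have "x * (e * e + f * f) = g * e - h * f" "y * (e * e + f * f) = g * f + h * e"
      "z * (e * e + f * f) = z * e * e + z * f * f"
      by (simp_all add: g_def h_def algebra_simps)
    then have "x = g * e - h * f" "y = g * f + h * e" "z = z * e * e + z * f * f"
      by (simp_all only: ef mult_1_right)
    ultimately show "tab2 x y z 0 i j = (\<Sum>k<2. sqrt (\<mu> k) * a k i * b k j)" if "i < 2" "j < 2"
        for i j
      using that rs(1,2) unfolding two by (auto simp: a_def b_def tab2_def sum_lessThan_2)
  qed (use mn in \<open>auto simp: m_def n_def\<close>)
qed

section \<open>Coordinates of the initial states\<close>

lemma psi_state_index:
  assumes "A < 2" "B < 2"
  shows "psi_state \<theta> $ (2 * A + B) = complex_of_real (if A = B then if A
      = 0 then cos \<theta> else sin \<theta> else 0)"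
proof -
  have "A = 0 \<or> A = 1" "B = 0 \<or> B = 1" using assms by auto
  then show ?thesis by (auto simp: psi_state_def ket_def bits_index_def)
qed

lemma W_state_index:
  assumes "j < 8"
  shows "W_state \<alpha> \<beta> \<gamma> $ j
    = complex_of_real (if j = 1 then \<alpha> else if j = 2 then \<beta> else if j = 4 then \<gamma> else 0)"
  using assms by (auto simp: W_state_def ket_def bits_index_def)

lemma global_state_index:
  assumes "A < 2" "B < 2" "A' < 2" "B' < 2" "k < 2"
  shows "global_state \<theta> \<alpha> \<beta> \<gamma> $ bits_index [A, B, A', B', k]
    = psi_state \<theta> $ (2 * A + B) * W_state \<alpha> \<beta> \<gamma> $ (4 * A' + 2 * B' + k)"
proof -
  have dims: "dim_vec (psi_state \<theta>) = 4" "dim_vec (W_state \<alpha> \<beta> \<gamma>) = 8"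
    by (simp_all add: psi_state_def W_state_def ket_def)
  have idx: "bits_index [A, B, A', B', k] = (2 * A + B) * 8 + (4 * A' + 2 * B' + k)"
    by (simp add: bits_index_def)
  have "4 * A' + 2 * B' + k < 8" "2 * A + B < 4" using assms by auto
  from block_index[OF this(2,1)] show ?thesis
    by (simp add: global_state_def kron_vec_def dims idx)
qed

text \<open>In the W state K is 1 only in the term with coefficient \<alpha>, so the outcome of the
  Bank is visible only as the sign of that coefficient.\<close>

lemma bank_projected_index:
  fixes s :: bank_outcome
  defines "\<sigma> \<equiv> case s of Plus \<Rightarrow> 1 | Minus \<Rightarrow> - 1"
  assumes "A < 2" "A' < 2" "B < 2" "B' < 2"
  shows "bank_projected \<theta> \<alpha> \<beta> \<gamma> s $ ((A * 2 + A') * 4 + (B * 2 + B'))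
    = complex_of_real (1 / sqrt 2 * (if A = B then if A = 0 then cos \<theta> else sin \<theta> else 0)
        * tab2 (\<sigma> * \<alpha>) \<beta> \<gamma> 0 A' B')"
proof -
  let ?i = "(A * 2 + A') * 4 + (B * 2 + B')"
  have two: "x = 0 \<or> x = 1" if "x < 2" for x :: nat using that by auto
  note cases = two[OF assms(2)] two[OF assms(3)] two[OF assms(4)] two[OF assms(5)]
  have bits: "bit_of ?i 3 = A" "bit_of ?i 2 = A'" "bit_of ?i 1 = B" "bit_of ?i 0 = B'" "?i < 16"
    using cases by (auto simp: bit_of_def)
  have ket: "bank_ket s $ 0 = complex_of_real (1 / sqrt 2)" "bank_ket s $ Suc 0
      = complex_of_real (\<sigma> / sqrt 2)"
    by (auto simp: bank_ket_def ket_def bits_index_def \<sigma>_def split: bank_outcome.split)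
  have W: "W_state \<alpha> \<beta> \<gamma> $ (4 * A' + 2 * B') + complex_of_real \<sigma> * W_state \<alpha> \<beta> \<gamma> $ (4 * A' + 2
      * B' + 1)
      = complex_of_real (tab2 (\<sigma> * \<alpha>) \<beta> \<gamma> 0 A' B')"
    using cases(2,4) by (auto simp: W_state_index tab2_def)
  have "bank_projected \<theta> \<alpha> \<beta> \<gamma> s $ ?i
    = complex_of_real (1 / sqrt 2) * psi_state \<theta> $ (2 * A + B)
      * (W_state \<alpha> \<beta> \<gamma> $ (4 * A' + 2 * B') + complex_of_real \<sigma> * W_state \<alpha> \<beta> \<gamma> $ (4 * A' + 2 * B'
          + 1))"
    using bits assms(2-5)
    by (simp add: bank_projected_def global_state_index ket sum_lessThan_2 algebra_simps)
  also have "\<dots> = complex_of_real (1 / sqrt 2 * (if A = B then if A = 0 then cos \<theta> else sin \<theta> else 0)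
        * tab2 (\<sigma> * \<alpha>) \<beta> \<gamma> 0 A' B')"
    unfolding W psi_state_index[OF assms(2,4)] by simp
  finally show ?thesis .
qed

lemma sum_sixteen:
  fixes f :: "nat \<Rightarrow> real"
  shows "(\<Sum>i<16. f i) = (\<Sum>A<2. \<Sum>A'<2. \<Sum>B<2. \<Sum>B'<2. f ((A * 2 + A') * 4 + (B * 2 + B')))"
proof -
  have four: "(\<Sum>i<4. g i) = (\<Sum>A<2. \<Sum>k<2. g (A * 2 + k))" for g :: "nat \<Rightarrow> real"
    using sum_mult_block[of g 2 2] by simp
  show ?thesis using sum_mult_block[of f 4 4] by (simp add: four)
qed

text \<open>The sign enters through its square alone, so both outcomes are equally likely and both
  branches are rescaled by the same factor.\<close>

lemma bank_prob_half:
  assumes "\<alpha>\<^sup>2 + \<beta>\<^sup>2 + \<gamma>\<^sup>2 = 1"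
  shows "bank_prob \<theta> \<alpha> \<beta> \<gamma> s = 1 / 2"
proof -
  define \<sigma> :: real where "\<sigma> = (case s of Plus \<Rightarrow> 1 | Minus \<Rightarrow> - 1)"
  have "\<sigma>\<^sup>2 = 1" by (simp add: \<sigma>_def split: bank_outcome.split)
  have "bank_prob \<theta> \<alpha> \<beta> \<gamma> s = (\<Sum>A<2. \<Sum>A'<2. \<Sum>B<2. \<Sum>B'<2.
      (1 / sqrt 2 * (if A = B then if A = (0 :: nat) then cos \<theta> else sin \<theta> else 0) * tab2 (\<sigma>
          * \<alpha>) \<beta> \<gamma> 0 A' B')\<^sup>2)"
    unfolding bank_prob_def sum_sixteen
    by (intro sum.cong refl) (simp only: lessThan_iff bank_projected_index norm_of_real power2_abs
        \<sigma>_def)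
  also have "\<dots> = (cos \<theta>)\<^sup>2 * (\<sigma>\<^sup>2 * \<alpha>\<^sup>2 + \<beta>\<^sup>2 + \<gamma>\<^sup>2) / 2
      + (sin \<theta>)\<^sup>2 * (\<sigma>\<^sup>2 * \<alpha>\<^sup>2 + \<beta>\<^sup>2 + \<gamma>\<^sup>2) / 2"
    by (simp add: sum_lessThan_2 tab2_def power_mult_distrib power_divide) (simp add:
        algebra_simps add_divide_distrib)
  also have "\<sigma>\<^sup>2 * \<alpha>\<^sup>2 + \<beta>\<^sup>2 + \<gamma>\<^sup>2 = 1"
    using assms \<open>\<sigma>\<^sup>2 = 1\<close> by simp
  finally show ?thesis by (simp add: sin_squared_eq diff_divide_distrib)
qed

lemma cos_sin_facts:
  assumes "0 < \<theta>" "\<theta> \<le> pi / 4"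
  shows "0 < cos \<theta>" "0 < sin \<theta>" "1 / 2 \<le> (cos \<theta>)\<^sup>2"
proof -
  show c: "0 < cos \<theta>" using assms by (intro cos_gt_zero_pi) auto
  show "0 < sin \<theta>" using assms by (intro sin_gt_zero) auto
  have "0 \<le> cos (2 * \<theta>)" using assms by (intro cos_ge_zero) auto
  then show "1 / 2 \<le> (cos \<theta>)\<^sup>2" by (simp add: cos_double_cos)
qed

section \<open>Optimal values in the two models\<close>

lemma bank_branch_maximum:
  assumes \<theta>: "0 < \<theta>" "\<theta> \<le> pi / 4" and pos: "\<alpha> > 0" "\<beta> > 0" "\<gamma> > 0"
    and norm: "\<alpha>\<^sup>2 + \<beta>\<^sup>2 + \<gamma>\<^sup>2 = 1"
  shows "is_maximum (achievable_probs 4 4 (proj (bank_branch \<theta> \<alpha> \<beta> \<gamma> s))) (P_max_W_meas \<theta> \<beta> \<gamma>)"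
proof -
  define \<sigma> :: real where "\<sigma> = (case s of Plus \<Rightarrow> 1 | Minus \<Rightarrow> - 1)"
  have \<sigma>: "\<sigma>\<^sup>2 = 1" "\<sigma> \<noteq> 0" by (simp_all add: \<sigma>_def split: bank_outcome.split)
  define \<mu> where "\<mu> = (\<lambda>k :: nat. if k = 0 then (1 + sqrt (1 - 4 * \<beta>\<^sup>2 * \<gamma>\<^sup>2)) / 2
    else (1 - sqrt (1 - 4 * \<beta>\<^sup>2 * \<gamma>\<^sup>2)) / 2)"
  define q where "q = (\<lambda>A :: nat. if A = 0 then (cos \<theta>)\<^sup>2 else (sin \<theta>)\<^sup>2)"
  note cs = cos_sin_facts[OF \<theta>]
  have n: "(\<sigma> * \<alpha>)\<^sup>2 + \<beta>\<^sup>2 + \<gamma>\<^sup>2 = 1" using norm \<sigma> by (simp add: power_mult_distrib)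
  have nz: "\<sigma> * \<alpha> \<noteq> 0" "\<beta> \<noteq> 0" "\<gamma> \<noteq> 0" using pos \<sigma> by auto
  let ?v = "bank_branch \<theta> \<alpha> \<beta> \<gamma> s"
  show ?thesis
  proof (rule singular_value_decomposition[OF n nz \<mu>_def])
    fix a b :: "nat \<Rightarrow> nat \<Rightarrow> real"
    assume ab:
      "\<And>k l. k < 2 \<Longrightarrow> l < 2 \<Longrightarrow> (\<Sum>c<2. a k c * a l c) = (if k = l then 1 else 0)"
      "\<And>c e. c < 2 \<Longrightarrow> e < 2 \<Longrightarrow> (\<Sum>k<2. a k c * a k e) = (if c = e then 1 else 0)"
      "\<And>k l. k < 2 \<Longrightarrow> l < 2 \<Longrightarrow> (\<Sum>c<2. b k c * b l c) = (if k = l then 1 else 0)"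
      "\<And>c e. c < 2 \<Longrightarrow> e < 2 \<Longrightarrow> (\<Sum>k<2. b k c * b k e) = (if c = e then 1 else 0)"
      "\<And>i j. i < 2 \<Longrightarrow> j < 2 \<Longrightarrow> tab2 (\<sigma> * \<alpha>) \<beta> \<gamma> 0 i j = (\<Sum>k<2. sqrt (\<mu> k) * a k i * b k j)"
      and \<mu>: "0 < \<mu> 0" "0 < \<mu> 1" "\<mu> 0 + \<mu> 1 = 1" "1 / 2 \<le> \<mu> 0"
    have "is_maximum (achievable_probs (2 * 2) 4 (proj ?v)) (min 1 (2 * (1 - q 0 * \<mu> 0)))"
    proof (rule product_state_maximum[where a = a and b = b and zs
        = "[]", OF _ _ ab(1) _ ab(3,4) _ _ _ _ \<mu>])
      show "?v \<in> carrier_vec (2 * 2 * 4)"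
        by (simp add: bank_branch_def bank_projected_def)
      fix A A' B B' :: nat assume lt: "A < 2" "A' < 2" "B < 2" "B' < 2"
      have "(A * 2 + A') * 4 + (B * 2 + B') < 16" using lt by auto
      then have "amp 4 ?v (A * 2 + A') (B * 2 + B')
        = complex_of_real (1 / sqrt (1 / 2)) * bank_projected \<theta> \<alpha> \<beta> \<gamma> s $ ((A * 2 + A') * 4 + (B
            * 2 + B'))"
        by (simp add: amp_def bank_branch_def bank_prob_half[OF norm] bank_projected_def)
      also have "\<dots> = complex_of_real ((1 / sqrt (1 / 2) * (1 / sqrt 2))
          * (if A = B then if A = 0 then cos \<theta> else sin \<theta> else 0) * tab2 (\<sigma> * \<alpha>) \<beta> \<gamma> 0 A' B')"
        unfolding bank_projected_index[OF lt] \<sigma>_def by simp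
      also have "1 / sqrt (1 / 2) * (1 / sqrt 2) = 1" by (simp add: real_sqrt_divide)
      also have "(if A = B then if A = 0 then cos \<theta> else sin \<theta> else 0) = (if A
          = B then sqrt (q A) else 0)"
        using cs by (simp add: q_def)
      finally show "amp 4 ?v (A * 2 + A') (B * 2 + B') = complex_of_real ((if A
          = B then sqrt (q A) else 0)
          * (\<Sum>k<2. sqrt (\<mu> k) * a k A' * b k B'))"
        using ab(5) lt by simp
    qed (use cs ab in \<open>auto simp: q_def\<close>)
    moreover have "min 1 (2 * (1 - q 0 * \<mu> 0)) = P_max_W_meas \<theta> \<beta> \<gamma>"
      by (simp add: q_def \<mu>_def P_max_W_meas_def right_diff_distrib)
    ultimately show ?thesis by simp
  qed
qed

lemma transfer_maximum:
  assumes \<theta>: "0 < \<theta>" "\<theta> \<le> pi / 4" and pos: "\<alpha> > 0" "\<beta> > 0" "\<gamma> > 0"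
    and norm: "\<alpha>\<^sup>2 + \<beta>\<^sup>2 + \<gamma>\<^sup>2 = 1"
  shows "is_maximum (achievable_probs 8 4 (proj (transfer_state \<theta> \<alpha> \<beta> \<gamma>))) (P_max_W_trans \<theta> \<beta>)"
proof -
  let ?v = "transfer_state \<theta> \<alpha> \<beta> \<gamma>"
  note cs = cos_sin_facts[OF \<theta>]
  define q where "q = (\<lambda>A :: nat. if A = 0 then (cos \<theta>)\<^sup>2 else (sin \<theta>)\<^sup>2)"
  define n where "n = sqrt (1 - \<beta>\<^sup>2)"
  have n2: "1 - \<beta>\<^sup>2 = \<alpha>\<^sup>2 + \<gamma>\<^sup>2" using norm by simp
  have n: "0 < n" "n * n = \<alpha> * \<alpha> + \<gamma> * \<gamma>" "0 < 1 - \<beta>\<^sup>2"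
    unfolding n_def n2 using pos by (auto simp: power2_eq_square
        intro!: add_pos_pos real_sqrt_gt_zero)
  \<comment> \<open>\<open>h\<close> is the position of the term with B' = 0, whose weight is
    \<open>1 - \<beta>\<^sup>2\<close>; it is chosen so that position 0 always holds the larger
    weight.\<close>
  define h :: nat where "h = (if 1 / 2 \<le> \<beta>\<^sup>2 then 1 else 0)"
  define \<mu> where "\<mu> = (\<lambda>k. if k = h then 1 - \<beta>\<^sup>2 else \<beta>\<^sup>2)"
  define a where "a = (\<lambda>k i :: nat. if k = h then if i = 1 then \<alpha> / n else if i
      = 2 then \<gamma> / n else 0
    else if i = 0 then 1 else 0)"
  define b where "b = (\<lambda>k i :: nat. if (k = h) = (i = 0) then 1 else 0 :: real)"
  \<comment> \<open>On A'K the Schmidt vectors are |00> and a unit vector in the span of |01> and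
    |10>. The complement consists of the orthogonal vector in that span and |11>.\<close>
  define zs where "zs = [\<lambda>i :: nat. if i = 1 then \<gamma> / n else if i = 2 then - \<alpha> / n else 0,
    \<lambda>i. if i = 3 then 1 else 0]"
  have frac: "\<alpha> / n * (\<alpha> / n) + \<gamma> / n * (\<gamma> / n) = 1"
    using n pos by (simp flip: add_divide_distrib)
  have h: "h = 0 \<or> h = 1" by (simp add: h_def)
  have two: "i < 2 \<longleftrightarrow> i = 0 \<or> i = 1" for i :: nat by auto
  have four: "i < 4 \<longleftrightarrow> i = 0 \<or> i = 1 \<or> i = 2 \<or> i = 3" for i :: nat by auto
  have "is_maximum (achievable_probs (2 * 4) 4 (proj ?v)) (min 1 (2 * (1 - q 0 * \<mu> 0)))"
  proof (rule product_state_maximum[where a = a and b = b and zs = zs])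
    show "?v \<in> carrier_vec (2 * 4 * 4)" by (simp add: transfer_state_def)
    fix A A' B B' :: nat assume lt: "A < 2" "A' < 4" "B < 2" "B' < 2"
    \<comment> \<open>Here \<open>A'\<close> runs over the joint index of the registers A' and K;
      \<open>C\<close> is the digit of A' and \<open>K\<close> the digit of K.\<close>
    define C K where "C = A' div 2" and "K = A' mod 2"
    have CK: "A' = C * 2 + K" "C < 2" "K < 2" using lt by (auto simp: C_def K_def)
    let ?i = "(A * 4 + A') * 4 + (B * 2 + B')"
    have bits: "bit_of ?i 4 = A" "bit_of ?i 3 = C" "bit_of ?i 2 = K" "bit_of ?i 1
        = B" "bit_of ?i 0 = B'" "?i < 32"
      using lt(1,3,4) CK unfolding two by (auto simp: bit_of_def)
    have "amp 4 ?v (A * 4 + A') (B * 2 + B')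
      = complex_of_real ((if A = B then if A = 0 then cos \<theta> else sin \<theta> else 0)
        * (if 4 * C + 2 * B' + K = 1 then \<alpha> else if 4 * C + 2 * B' + K = 2 then \<beta>
           else if 4 * C + 2 * B' + K = 4 then \<gamma> else 0))"
      unfolding of_real_mult using bits lt CK(2,3)
      by (simp add: amp_def transfer_state_def global_state_index psi_state_index W_state_index)
    also have "(if A = B then if A = 0 then cos \<theta> else sin \<theta> else 0) = (if A
        = B then sqrt (q A) else 0)"
      using cs by (simp add: q_def)
    also have "(if 4 * C + 2 * B' + K = 1 then \<alpha> else if 4 * C + 2 * B' + K = 2 then \<beta>
           else if 4 * C + 2 * B' + K = 4 then \<gamma> else 0) = (\<Sum>k<2. sqrt (\<mu> k) * a k A' * b k B')"
      using CK(2,3) lt(4) h n(1) pos unfolding CK(1) two sum_lessThan_2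
      by (auto simp: \<mu>_def a_def b_def simp flip: n_def)
    finally show "amp 4 ?v (A * 4 + A') (B * 2 + B') = complex_of_real ((if A
        = B then sqrt (q A) else 0)
        * (\<Sum>k<2. sqrt (\<mu> k) * a k A' * b k B'))" .
  next
    show "(\<Sum>c<4. a k c * a l c) = (if k = l then 1 else 0)" if "k < 2" "l < 2" for k l
      using that h frac unfolding two sum_lessThan_4 by (auto simp: a_def)
    show "(\<Sum>k<2. a k c * a k e) + (\<Sum>z\<leftarrow>zs. z c * z e) = (if c = e then 1 else 0)"
        if "c < 4" "e < 4" for c e
      using that h frac unfolding four sum_lessThan_2 by (auto simp: a_def zs_def add.commute)
    show "(\<Sum>c<2. b k c * b l c) = (if k = l then 1 else 0)" if "k < 2" "l < 2" for k l
      using that h unfolding two sum_lessThan_2 by (auto simp: b_def)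
    show "(\<Sum>k<2. b k c * b k e) = (if c = e then 1 else 0)" if "c < 2" "e < 2" for c e
      using that h unfolding two sum_lessThan_2 by (auto simp: b_def)
    show "0 < \<mu> 0" "0 < \<mu> 1" "\<mu> 0 + \<mu> 1 = 1" "1 / 2 \<le> \<mu> 0"
      using n(3) pos by (auto simp: \<mu>_def h_def)
  qed (use cs in \<open>auto simp: q_def\<close>)
  moreover have "\<mu> 0 = max (\<beta>\<^sup>2) (1 - \<beta>\<^sup>2)" by (auto simp: \<mu>_def h_def)
  ultimately show ?thesis by (simp add: q_def P_max_W_trans_def)
qed

text \<open>Success is certain exactly when the largest squared Schmidt coefficient \<open>(cos
  \<theta>)\<^sup>2 * (1 + sqrt (1 - 4 * \<beta>\<^sup>2 * \<gamma>\<^sup>2)) / 2\<close> is at most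
  1/2; division by the squared cosine and squaring give the stated form.\<close>

lemma P_max_W_meas_eq_1_iff:
  assumes \<theta>: "0 < \<theta>" "\<theta> \<le> pi / 4" and D: "4 * \<beta>\<^sup>2 * \<gamma>\<^sup>2 < 1"
  shows "P_max_W_meas \<theta> \<beta> \<gamma> = 1 \<longleftrightarrow> 4 * \<beta>\<^sup>2 * \<gamma>\<^sup>2 \<ge> 1 - (tan \<theta>) ^ 4"
proof -
  have c: "0 < (cos \<theta>)\<^sup>2" using cos_sin_facts(1)[OF \<theta>] by simp
  let ?S = "sqrt (1 - 4 * \<beta>\<^sup>2 * \<gamma>\<^sup>2)"
  have "P_max_W_meas \<theta> \<beta> \<gamma> = 1 \<longleftrightarrow> (cos \<theta>)\<^sup>2 * (1 + ?S) \<le> 1"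
    by (auto simp: P_max_W_meas_def)
  also have "\<dots> \<longleftrightarrow> (cos \<theta>)\<^sup>2 * ?S \<le> (sin \<theta>)\<^sup>2"
    unfolding sin_squared_eq by (auto simp: distrib_left)
  also have "\<dots> \<longleftrightarrow> ?S \<le> (tan \<theta>)\<^sup>2"
    using c by (simp add: tan_def power_divide pos_le_divide_eq mult.commute)
  also have "\<dots> \<longleftrightarrow> 1 - 4 * \<beta>\<^sup>2 * \<gamma>\<^sup>2 \<le> ((tan \<theta>)\<^sup>2)\<^sup>2"
    using D by (metis real_sqrt_le_iff real_sqrt_abs abs_of_nonneg zero_le_power2)
  also have "((tan \<theta>)\<^sup>2)\<^sup>2 = (tan \<theta>) ^ 4" by simp
  finally show ?thesis by linarith
qed

theorem mainTheorem8:
  fixes \<theta> \<alpha> \<beta> \<gamma> :: real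
  assumes "0 < \<theta>" and "\<theta> \<le> pi / 4"
    and "\<alpha> > 0" and "\<beta> > 0" and "\<gamma> > 0"
    and "\<alpha>\<^sup>2 + \<beta>\<^sup>2 + \<gamma>\<^sup>2 = 1"
  shows "(\<forall>s. is_maximum (achievable_probs 4 4 (proj (bank_branch \<theta> \<alpha> \<beta> \<gamma> s)))
                (P_max_W_meas \<theta> \<beta> \<gamma>))
    \<and> is_maximum (bank_achievable_probs \<theta> \<alpha> \<beta> \<gamma>) (P_max_W_meas \<theta> \<beta> \<gamma>)
    \<and> (P_max_W_meas \<theta> \<beta> \<gamma> = 1 \<longleftrightarrow> 4 * \<beta>\<^sup>2 * \<gamma>\<^sup>2 \<ge> 1 - (tan \<theta>) ^ 4)
    \<and> is_maximum (achievable_probs 8 4 (proj (transfer_state \<theta> \<alpha> \<beta> \<gamma>)))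
        (P_max_W_trans \<theta> \<beta>)"
proof (intro conjI allI)
  let ?m = "P_max_W_meas \<theta> \<beta> \<gamma>"
  let ?r = "\<lambda>P s. restoring_prob P 4 4 (proj (bank_branch \<theta> \<alpha> \<beta> \<gamma> s))"
  show branch: "is_maximum (achievable_probs 4 4 (proj (bank_branch \<theta> \<alpha> \<beta> \<gamma> s))) ?m" for s
    by (rule bank_branch_maximum[OF assms])
  have upper: "?r P s \<le> ?m" if "is_protocol P 4 4" for P s
    using branch[of s] that by (auto simp: is_maximum_def achievable_probs_def)
  have "\<exists>P. is_protocol P 4 4 \<and> ?r P s = ?m" for s
    using branch[of s] unfolding is_maximum_def achievable_probs_def by force
  then obtain P where P: "\<And>s. is_protocol (P s) 4 4" "\<And>s. ?r (P s) s = ?m" by metis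
  \<comment> \<open>A complete run averages the two branches with equal weight. Since the branches
    share their optimum and the protocols are chosen independently, the average has the same
    optimum.\<close>
  have total: "(\<Sum>s\<in>{Plus, Minus}. bank_prob \<theta> \<alpha> \<beta> \<gamma> s * ?r (R s) s)
      = (?r (R Plus) Plus + ?r (R Minus) Minus) / 2" for R
    by (simp add: bank_prob_half[OF assms(6)])
  show "is_maximum (bank_achievable_probs \<theta> \<alpha> \<beta> \<gamma>) ?m"
    unfolding is_maximum_def
  proof
    show "?m \<in> bank_achievable_probs \<theta> \<alpha> \<beta> \<gamma>"
      unfolding bank_achievable_probs_def total using P by (auto intro!: exI[of _ P])
    show "\<forall>x\<in>bank_achievable_probs \<theta> \<alpha> \<beta> \<gamma>. x \<le> ?m"
    proof
      fix x assume "x \<in> bank_achievable_probs \<theta> \<alpha> \<beta> \<gamma>"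
      then obtain R where R: "\<forall>s. is_protocol (R s) 4 4" "x
          = (?r (R Plus) Plus + ?r (R Minus) Minus) / 2"
        unfolding bank_achievable_probs_def total by auto
      with upper[of "R Plus" Plus] upper[of "R Minus" Minus] show "x \<le> ?m" by simp
    qed
  qed
  have "4 * \<beta>\<^sup>2 * \<gamma>\<^sup>2 < 1"
    using assms(3) by (intro discriminant_less_1[OF assms(6)]) simp
  then show "?m = 1 \<longleftrightarrow> 4 * \<beta>\<^sup>2 * \<gamma>\<^sup>2 \<ge> 1 - (tan \<theta>) ^ 4"
    by (rule P_max_W_meas_eq_1_iff[OF assms(1,2)])
  show "is_maximum (achievable_probs 8 4 (proj (transfer_state \<theta> \<alpha> \<beta> \<gamma>))) (P_max_W_trans \<theta> \<beta>)"
    by (rule transfer_maximum[OF assms])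
qed

end
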